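(* Let $n\ge 1$ and let $k_1,\ldots,k_n$ be non-negative integers. Let $u:\mathbb{D}^n\to\mathbb{C}$ be a nonzero analytic function and let $v:\mathbb{D}^n\to\mathbb{D}^n$, $v(z_1,\ldots,z_n)=(v_1(z_1),\ldots,v_n(z_n))$, be an analytic self-map of $\mathbb{D}^n$ such that $W_{u,v,k_1,\ldots,k_n}$ is bounded on $H^2(\mathbb{D}^n)$. Then $W_{u,v,k_1,\ldots,k_n}$ is Hermitian if and only if $$u(z_1,\ldots,z_n)=a\prod_{i=1}^{n}\frac{z_i^{k_i}}{(1-\overline{c_i}z_i)^{k_i+1}}\quad\text{and}\quad v_j(z_j)=\frac{(d_j-|c_j|^2)z_j+c_j}{1-\overline{c_j}z_j}\quad\text{for } j=1,\ldots,n,$$ where $a,d_j\in\mathbb{R}$ and $c_j\in\mathbb{C}$ for $j=1,\ldots,n$.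
   Context: $\mathbb{D}$ is the open unit disk in $\mathbb{C}$, $\mathbb{D}^n$ the polydisk, $\mathbb{T}^n$ the torus with normalized Haar measure $\sigma$. $H^2(\mathbb{D}^n)$ is the Hardy space of analytic $f:\mathbb{D}^n\to\mathbb{C}$ with $\|f\|^2=\sup_{0<r<1}\int_{\mathbb{T}^n}|f(r\zeta)|^2\,d\sigma(\zeta)<\infty$; it is a Hilbert space in which the monomials $\prod_i z_i^{m_i}$ ($m_i\ge 0$) form an orthonormal basis. In $v=(v_1,\ldots,v_n)$ each $v_j$ is an analytic self-map of $\mathbb{D}$ depending only on $z_j$. "Nonzero" means not identically zero. The weighted composition-differentiation operator is $W_{u,v,k_1,\ldots,k_n}f(z)=u(z)\,\frac{\partial^{m}f}{\partial z_1^{k_1}\cdots\partial z_n^{k_n}}(v(z))$ with $m=\sum_{i=1}^n k_i$. A bounded operator $T$ is Hermitian if $T^*=T$. *)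

theory Defs
  imports "HOL-Complex_Analysis.Complex_Analysis"
begin

text \<open>
  The coordinates are indexed by a finite, linearly ordered type \<open>'n\<close>, so that \<open>n = CARD('n) \<ge> 1\<close>.
  The order is used only to fix the order of differentiation in a mixed partial derivative.
\<close>

definition polydisk :: "(complex ^ 'n::finite) set" where
  "polydisk = {z. \<forall>j. norm (z $ j) < 1}"

text \<open>Analyticity in several variables: complex Frechet differentiability at every point of an
  open set \<open>S\<close>.\<close>

definition analytic_vec_on :: "(complex ^ 'n::finite \<Rightarrow> complex) \<Rightarrow> (complex ^ 'n) set \<Rightarrow> bool" where
  "analytic_vec_on f S \<longleftrightarrow>
     (\<forall>z\<in>S. \<exists>L. (f has_derivative L) (at z) \<and> (\<forall>c x. L (c *s x) = c * L x))"

text \<open>Normalized Haar measure on the torus: the image of the uniform distribution on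
  \<open>[0, 2\<pi>]\<^sup>n\<close> under \<open>\<theta> \<mapsto> (exp (i \<theta>\<^sub>j))\<^sub>j\<close>.\<close>

definition torus_measure :: "(complex ^ 'n::finite) measure" where
  "torus_measure =
     distr (\<Pi>\<^sub>M j\<in>UNIV. uniform_measure lborel {0..2 * pi}) borel (\<lambda>\<theta>. \<chi> j. cis (\<theta> j))"

text \<open>A function on the polydisk is represented by its extension by zero, so that equality in
  \<open>H2\<close> is equality of functions on the polydisk.\<close>

definition H2 :: "(complex ^ 'n::finite \<Rightarrow> complex) set" where
  "H2 = {f. analytic_vec_on f polydisk \<and> (\<forall>z. z \<notin> polydisk \<longrightarrow> f z = 0) \<and>
     bdd_above ((\<lambda>r. LINT \<zeta>|torus_measure. (norm (f (r *\<^sub>R \<zeta>)))\<^sup>2) ` {0<..<1})}"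

definition H2_norm :: "(complex ^ 'n::finite \<Rightarrow> complex) \<Rightarrow> real" where
  "H2_norm f = sqrt (SUP r\<in>{0<..<1}. LINT \<zeta>|torus_measure. (norm (f (r *\<^sub>R \<zeta>)))\<^sup>2)"

text \<open>The inner product inducing \<open>H2_norm\<close>. The integral means of \<open>\<bar>f\<bar>\<^sup>2\<close> increase with the radius,
  so their supremum is their limit, and by polarization the limit below exists for all \<open>f\<close>, \<open>g\<close>
  in \<open>H2\<close>.\<close>

definition H2_inner ::
    "(complex ^ 'n::finite \<Rightarrow> complex) \<Rightarrow> (complex ^ 'n \<Rightarrow> complex) \<Rightarrow> complex" where
  "H2_inner f g =
     Lim (at_left 1) (\<lambda>r::real. LINT \<zeta>|torus_measure. f (r *\<^sub>R \<zeta>) * cnj (g (r *\<^sub>R \<zeta>)))"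

definition H2_bounded ::
    "((complex ^ 'n::finite \<Rightarrow> complex) \<Rightarrow> (complex ^ 'n \<Rightarrow> complex)) \<Rightarrow> bool" where
  "H2_bounded T \<longleftrightarrow>
     (\<forall>f\<in>H2. T f \<in> H2) \<and> (\<exists>C. \<forall>f\<in>H2. H2_norm (T f) \<le> C * H2_norm f)"

definition H2_adjoint ::
    "((complex ^ 'n::finite \<Rightarrow> complex) \<Rightarrow> (complex ^ 'n \<Rightarrow> complex)) \<Rightarrow>
     (complex ^ 'n \<Rightarrow> complex) \<Rightarrow> (complex ^ 'n \<Rightarrow> complex)" where
  "H2_adjoint T g = (THE h. h \<in> H2 \<and> (\<forall>f\<in>H2. H2_inner (T f) g = H2_inner f h))"

definition H2_hermitian ::
    "((complex ^ 'n::finite \<Rightarrow> complex) \<Rightarrow> (complex ^ 'n \<Rightarrow> complex)) \<Rightarrow> bool" where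
  "H2_hermitian T \<longleftrightarrow> H2_bounded T \<and> (\<forall>g\<in>H2. H2_adjoint T g = T g)"

definition partial_deriv ::
    "'n::finite \<Rightarrow> (complex ^ 'n \<Rightarrow> complex) \<Rightarrow> (complex ^ 'n \<Rightarrow> complex)" where
  "partial_deriv i f z = deriv (\<lambda>w. f (\<chi> j. if j = i then w else z $ j)) (z $ i)"

definition mixed_partial ::
    "('n::{finite,linorder} \<Rightarrow> nat) \<Rightarrow> ((complex, 'n) vec \<Rightarrow> complex) \<Rightarrow> ((complex, 'n) vec \<Rightarrow> complex)" where
  "mixed_partial k f = foldr (\<lambda>i. partial_deriv i ^^ k i) (sorted_list_of_set UNIV) f"

definition wcd_op ::
    "((complex, 'n::{finite,linorder}) vec \<Rightarrow> complex) \<Rightarrow> ((complex, 'n) vec \<Rightarrow> (complex, 'n) vec) \<Rightarrow>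
     ('n \<Rightarrow> nat) \<Rightarrow> ((complex, 'n) vec \<Rightarrow> complex) \<Rightarrow> ((complex, 'n) vec \<Rightarrow> complex)" where
  "wcd_op u v k f = (\<lambda>z. if z \<in> polydisk then u z * mixed_partial k f (v z) else 0)"

end

theory Submission
  imports Defs "HOL-Probability.Infinite_Product_Measure"
begin

text \<open>Every function in the Hardy space has a power series, and the norm and inner product are those of
  square-summable coefficient families. Mixed partial derivatives at \<open>w\<close> are therefore inner products with kernels
  \<open>H2_kernel k w\<close>. Applying the operator and its adjoint to the kernels \<open>H2_kernel 0 w\<close>, whose span is dense,
  turns self-adjointness into the functional equation
  \<open>cnj (u w) * H2_kernel k (v w) z = u z * cnj (H2_kernel k (v z) w)\<close>. Setting \<open>w = 0\<close> after cancelling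
  monomials determines \<open>u\<close>, and varying one coordinate at a time determines each \<open>v j\<close>.\<close>

no_notation fps_nth (infixl "$" 75)

section \<open>Analytic functions on the polydisk\<close>

text \<open>Two obstacles shape the solution of the functional equation. If some \<open>k i\<close>
  is positive, every kernel \<open>H2_kernel k b\<close> vanishes on the hyperplane where the
  \<open>i\<close>-th coordinate is 0, so the raw equation at \<open>w = 0\<close> says no more than
  that \<open>u 0 = 0\<close>. The monomial shared by \<open>u\<close> and the kernels has to be
  divided out, and the quotient has to be carried across the coordinate hyperplanes by continuity.
  Moreover, the denominators come with exponents \<open>k j + 1\<close>, so restriction to a
  coordinate axis gives only an equality of powers; the remaining root of unity is excluded by
  connectedness of the disk. The parameters are values at the origin: \<open>c j\<close> is
  \<open>v j 0\<close>, and \<open>a\<close> is the value at 0 of the quotient of \<open>u\<close>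
  by the monomial, real because the equation at the pair (0, 0) equates it with its conjugate. The
  slope \<open>d j - |c j|^2\<close> appears when one of the two variables is fixed, and the
  conjugate symmetry of the equation makes it real. In the converse direction, agreement of the
  operator and its adjoint on kernels reaches all of \<open>H2\<close> through boundedness.\<close>

lemma analytic_vec_on_const: "analytic_vec_on (\<lambda>z. c) S"
  unfolding analytic_vec_on_def by (auto intro!: exI[of _ "\<lambda>_. 0"])

lemma analytic_vec_on_nth: "analytic_vec_on (\<lambda>z. z $ i) S"
  unfolding analytic_vec_on_def
  by (auto intro!: exI[of _ "\<lambda>z. z $ i"] bounded_linear_imp_has_derivative bounded_linear_vec_nth)

lemma analytic_vec_on_add:
  assumes "analytic_vec_on f S" "analytic_vec_on g S"
  shows "analytic_vec_on (\<lambda>z. f z + g z) S"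
  unfolding analytic_vec_on_def
proof
  fix z assume z: "z \<in> S"
  obtain L where L: "(f has_derivative L) (at z)" "\<forall>c x. L (c *s x) = c * L x"
    using assms(1) z unfolding analytic_vec_on_def by blast
  obtain M where M: "(g has_derivative M) (at z)" "\<forall>c x. M (c *s x) = c * M x"
    using assms(2) z unfolding analytic_vec_on_def by blast
  show "\<exists>L. ((\<lambda>z. f z + g z) has_derivative L) (at z) \<and> (\<forall>c x. L (c *s x) = c * L x)"
    using L M by (intro exI[of _ "\<lambda>x. L x + M x"]) (auto simp: algebra_simps intro!: derivative_intros)
qed

lemma analytic_vec_on_mult:
  assumes "analytic_vec_on f S" "analytic_vec_on g S"
  shows "analytic_vec_on (\<lambda>z. f z * g z) S"
  unfolding analytic_vec_on_def
proof
  fix z assume z: "z \<in> S"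
  obtain L where L: "(f has_derivative L) (at z)" "\<forall>c x. L (c *s x) = c * L x"
    using assms(1) z unfolding analytic_vec_on_def by blast
  obtain M where M: "(g has_derivative M) (at z)" "\<forall>c x. M (c *s x) = c * M x"
    using assms(2) z unfolding analytic_vec_on_def by blast
  show "\<exists>L. ((\<lambda>z. f z * g z) has_derivative L) (at z) \<and> (\<forall>c x. L (c *s x) = c * L x)"
    using L M by (intro exI[of _ "\<lambda>x. f z * M x + L x * g z"])
      (auto simp: algebra_simps intro!: derivative_eq_intros)
qed

lemma analytic_vec_on_prod:
  "(\<And>i. i \<in> I \<Longrightarrow> analytic_vec_on (f i) S) \<Longrightarrow> analytic_vec_on (\<lambda>z. \<Prod>i\<in>I. f i z) S"
  by (induction I rule: infinite_finite_induct)
     (simp_all add: analytic_vec_on_const analytic_vec_on_mult)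

lemma analytic_vec_on_compose_holomorphic:
  assumes "analytic_vec_on f S" "h holomorphic_on T" "open T" "\<And>z. z \<in> S \<Longrightarrow> f z \<in> T"
  shows "analytic_vec_on (\<lambda>z. h (f z)) S"
  unfolding analytic_vec_on_def
proof
  fix z assume z: "z \<in> S"
  obtain L where L: "(f has_derivative L) (at z)" "\<forall>c x. L (c *s x) = c * L x"
    using assms(1) z unfolding analytic_vec_on_def by blast
  have "(h has_field_derivative deriv h (f z)) (at (f z))"
    using assms z holomorphic_derivI by blast
  then have h: "(h has_derivative (*) (deriv h (f z))) (at (f z))"
    by (simp add: has_field_derivative_def)
  show "\<exists>L. ((\<lambda>z. h (f z)) has_derivative L) (at z) \<and> (\<forall>c x. L (c *s x) = c * L x)"
    using L diff_chain_at[OF L(1) h]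
    by (intro exI[of _ "\<lambda>x. deriv h (f z) * L x"]) (auto simp: o_def)
qed

lemma analytic_vec_on_cong:
  assumes "open S" "\<And>z. z \<in> S \<Longrightarrow> f z = g z" "analytic_vec_on f S"
  shows "analytic_vec_on g S"
  unfolding analytic_vec_on_def
proof
  fix z assume z: "z \<in> S"
  obtain L where L: "(f has_derivative L) (at z)" "\<forall>c x. L (c *s x) = c * L x"
    using assms(3) z unfolding analytic_vec_on_def by blast
  then show "\<exists>L. (g has_derivative L) (at z) \<and> (\<forall>c x. L (c *s x) = c * L x)"
    using has_derivative_transform_within_open[OF L(1) assms(1) z assms(2)] by blast
qed

lemma analytic_vec_on_imp_continuous_on:
  assumes "analytic_vec_on f S"
  shows "continuous_on S f"
proof (rule continuous_at_imp_continuous_on, rule ballI)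
  fix z assume z: "z \<in> S"
  obtain L where L: "(f has_derivative L) (at z)"
    using assms z unfolding analytic_vec_on_def by blast
  then show "isCont f z"
    by (rule has_derivative_continuous)
qed

lemma bounded_linear_axis: "bounded_linear (axis i :: 'a::real_normed_vector \<Rightarrow> 'a ^ 'n::finite)"
proof (rule bounded_linear_intro[where K = 1])
  fix x :: 'a
  have "norm (axis i x :: 'a ^ 'n) = L2_set (\<lambda>j. if j = i then norm x else 0) UNIV"
    unfolding norm_vec_def by (rule L2_set_cong) (auto simp: axis_def)
  also have "\<dots> = norm x"
    unfolding L2_set_def by (simp add: if_distrib[of "\<lambda>x. x\<^sup>2"] cong: if_cong)
  finally show "norm (axis i x :: 'a ^ 'n) \<le> norm x * 1" by simp
qed (auto simp: vec_eq_iff axis_def)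

text \<open>Overwriting one coordinate is an affine map: a constant vector plus the bounded linear
  map \<open>axis i\<close>.\<close>

lemma has_derivative_vec_update:
  "((\<lambda>w. \<chi> j. if j = i then w else z $ j) has_derivative (\<lambda>w. axis i w))
     (at (x :: 'a :: real_normed_vector))"
proof -
  have "((\<lambda>w. (\<chi> j. if j = i then 0 else z $ j) + axis i w) has_derivative (\<lambda>w. 0 + axis i w)) (at x)"
    by (intro derivative_intros bounded_linear_imp_has_derivative bounded_linear_axis)
  also have "(\<lambda>w. (\<chi> j. if j = i then 0 else z $ j) + axis i w) = (\<lambda>w. \<chi> j. if j = i then w else z $ j)"
    by (auto simp: vec_eq_iff axis_def)
  finally show ?thesis by simp
qed

text \<open>By the chain rule the slice has derivative \<open>L (axis i x)\<close>, and complex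
  homogeneity of \<open>L\<close> turns this into multiplication by \<open>L (axis i 1)\<close>.
  One-variable Cauchy theory thereby applies in each coordinate separately.\<close>

lemma analytic_vec_on_slice_holomorphic:
  assumes "analytic_vec_on f S" "\<And>w. w \<in> T \<Longrightarrow> (\<chi> j. if j = i then w else z $ j) \<in> S"
  shows "(\<lambda>w. f (\<chi> j. if j = i then w else z $ j)) holomorphic_on T"
  unfolding holomorphic_on_def
proof
  fix w assume w: "w \<in> T"
  let ?p = "\<lambda>w. \<chi> j. if j = i then w else z $ j"
  obtain L where L: "(f has_derivative L) (at (?p w))" "\<forall>c x. L (c *s x) = c * L x"
    using assms w unfolding analytic_vec_on_def by blast
  have "((\<lambda>w. f (?p w)) has_derivative (\<lambda>x. L (axis i x))) (at w)"
    using diff_chain_at[OF has_derivative_vec_update L(1)] by (simp add: o_def)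
  moreover have "L (axis i x) = L (axis i 1) * x" for x
  proof -
    have "axis i x = x *s axis i 1" by (auto simp: vec_eq_iff axis_def)
    then show ?thesis using L(2) by simp
  qed
  then have "(\<lambda>x. L (axis i x)) = (*) (L (axis i 1))" by (rule ext)
  ultimately have "((\<lambda>w. f (?p w)) has_field_derivative L (axis i 1)) (at w)"
    unfolding has_field_derivative_def by (simp only:)
  then have "(\<lambda>w. f (?p w)) field_differentiable at w"
    unfolding field_differentiable_def by blast
  then show "(\<lambda>w. f (?p w)) field_differentiable at w within T"
    by (rule field_differentiable_at_within)
qed

section \<open>Topology of the polydisk\<close>

lemma polydiskD: "z \<in> polydisk \<Longrightarrow> norm (z $ i) < 1"
  by (simp add: polydisk_def)

lemma open_polydisk: "open (polydisk :: (complex ^ 'n::finite) set)"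
proof -
  have "open (\<Inter>i\<in>UNIV. {z :: complex ^ 'n. norm (z $ i) < 1})"
    by (intro open_INT finite ballI open_Collect_less continuous_intros)
  also have "(\<Inter>i\<in>UNIV. {z :: complex ^ 'n. norm (z $ i) < 1}) = polydisk"
    by (auto simp: polydisk_def)
  finally show ?thesis .
qed

lemma zero_in_polydisk: "0 \<in> polydisk"
  by (simp add: polydisk_def)

lemma compact_closed_polydisk: "compact {z :: complex ^ 'n::finite. \<forall>i. norm (z $ i) \<le> r}"
proof -
  have "{z :: complex ^ 'n. \<forall>i. norm (z $ i) \<le> r} = (\<Inter>i. {z. norm (z $ i) \<le> r})"
    by auto
  then have "closed {z :: complex ^ 'n. \<forall>i. norm (z $ i) \<le> r}"
    by (simp only:, intro closed_INT ballI closed_Collect_le continuous_intros)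
  moreover have "bounded {z :: complex ^ 'n. \<forall>i. norm (z $ i) \<le> r}"
  proof (rule boundedI)
    fix z :: "complex ^ 'n" assume "z \<in> {z. \<forall>i. norm (z $ i) \<le> r}"
    then show "norm z \<le> of_nat CARD('n) * r"
      using L2_set_le_sum[of UNIV "\<lambda>i. norm (z $ i)"] sum_bounded_above[of UNIV "\<lambda>i. norm (z $ i)" r]
      by (simp add: norm_vec_def)
  qed
  ultimately show ?thesis by (simp add: compact_eq_bounded_closed)
qed

lemma continuous_polydisk_bounded:
  assumes "continuous_on polydisk f" "r < 1"
  obtains B :: real where "B \<ge> 0" "\<And>z :: complex ^ 'n::finite. (\<And>i. norm (z $ i) \<le> r) \<Longrightarrow> norm (f z) \<le> B"
proof -
  have "{z. \<forall>i. norm (z $ i) \<le> r} \<subseteq> (polydisk :: (complex ^ 'n) set)"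
    using assms(2) by (auto simp: polydisk_def intro: le_less_trans)
  then have "bounded (f ` {z. \<forall>i. norm (z $ i) \<le> r})"
    using assms(1) compact_closed_polydisk[of r]
    by (intro compact_imp_bounded compact_continuous_image) (auto elim: continuous_on_subset)
  then obtain B where "\<And>z. (\<forall>i. norm (z $ i) \<le> r) \<Longrightarrow> norm (f z) \<le> B"
    unfolding bounded_iff by auto
  \<comment> \<open>For negative \<open>r\<close> the closed polydisk is empty and \<open>B\<close>
    may be negative, hence the maximum with 0.\<close>
  then show thesis by (intro that[of "max 0 B"]) (auto intro: le_max_iff_disj[THEN iffD2])
qed

section \<open>Integration over the torus\<close>

abbreviation angle_measure :: "real measure" where
  "angle_measure \<equiv> uniform_measure lborel {0..2 * pi}"

lemma prob_space_angle_measure: "prob_space angle_measure"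
  by (intro prob_space_uniform_measure) auto

text \<open>A bridge between the normalized Lebesgue integral, needed for products and Fubini, and
  the gauge integral in which contour integrals are evaluated.\<close>

lemma angle_integral:
  fixes f :: "real \<Rightarrow> complex"
  assumes "continuous_on UNIV f"
  shows "(LINT \<theta>|angle_measure. f \<theta>) = integral {0..2 * pi} f / (2 * pi)"
proof -
  have si: "set_integrable lborel {0..2 * pi} f"
    by (rule borel_integrable_atLeastAtMost') (use assms continuous_on_subset in blast)
  have m: "f \<in> borel_measurable borel"
    using assms by (rule borel_measurable_continuous_onI)
  have d: "angle_measure = density lborel (\<lambda>x. ennreal (indicator {0..2 * pi} x / (2 * pi)))"
    unfolding uniform_measure_def
    by (intro density_cong) (auto simp: divide_ennreal indicator_def ennreal_1[symmetric] simp del: ennreal_1)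
  have "(LINT \<theta>|angle_measure. f \<theta>) = (LINT x|lborel. (indicator {0..2 * pi} x / (2 * pi)) *\<^sub>R f x)"
    unfolding d using m by (intro integral_density) auto
  also have "\<dots> = (LINT x|lborel. (1 / (2 * pi)) *\<^sub>R indicator {0..2 * pi} x *\<^sub>R f x)"
    by (intro Bochner_Integration.integral_cong) auto
  also have "\<dots> = (1 / (2 * pi)) *\<^sub>R (LINT x:{0..2 * pi}|lborel. f x)"
    unfolding set_lebesgue_integral_def by (rule integral_scaleR_right)
  also have "\<dots> = integral {0..2 * pi} f / (2 * pi)"
    using set_borel_integral_eq_integral(2)[OF si] by (simp add: scaleR_conv_of_real divide_simps)
  finally show ?thesis .
qed

text \<open>Cauchy's formula on the circle of radius \<open>r\<close> at the point
  \<open>r * w\<close>. Under the parametrization by \<open>r * cis \<theta>\<close> the radius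
  cancels from the Cauchy kernel, leaving \<open>cis \<theta> / (cis \<theta> - w) = 1 / (1 - w *
  cis (- \<theta>))\<close>. In this form the kernel is a geometric series in
  \<open>w * cis (- \<theta>)\<close>, which later produces the power series.\<close>

lemma angle_Cauchy:
  fixes h :: "complex \<Rightarrow> complex"
  assumes h: "h holomorphic_on ball 0 1" and r: "0 < r" "r < 1" and w: "norm w < 1"
  shows "(LINT \<theta>|angle_measure. h (of_real r * cis \<theta>) * (1 / (1 - w * cis (- \<theta>)))) = h (of_real r * w)"
proof -
  let ?g = "\<lambda>\<theta>. h (of_real r * cis \<theta>) * (1 / (1 - w * cis (- \<theta>)))"
  have ne: "1 - w * cis (- \<theta>) \<noteq> 0" for \<theta>
    using w by (metis eq_iff_diff_eq_0 mult.right_neutral norm_cis norm_mult norm_one order_less_irrefl)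
  have ne': "cis \<theta> - w \<noteq> 0" for \<theta>
    using w by (metis eq_iff_diff_eq_0 norm_cis order_less_irrefl)
  have cont: "continuous_on UNIV ?g"
  proof (intro continuous_on_mult continuous_on_divide)
    show "continuous_on UNIV (\<lambda>\<theta>. h (of_real r * cis \<theta>))"
      by (rule continuous_on_compose2[OF holomorphic_on_imp_continuous_on[OF h]])
        (use r in \<open>auto simp: norm_mult intro!: continuous_intros\<close>)
  qed (use ne in \<open>auto intro!: continuous_intros\<close>)
  have "((\<lambda>u. h u / (u - of_real r * w)) has_contour_integral (2 * of_real pi * \<i> * h (of_real r * w))) (circlepath 0 r)"
    using r w h by (intro Cauchy_integral_circlepath_simple)
      (auto simp: norm_mult elim!: holomorphic_on_subset)
  then have "((\<lambda>t. h (0 + r * cis t) / (0 + r * cis t - of_real r * w) * r * \<i> * cis t) has_integral (2 * of_real pi * \<i> * h (of_real r * w))) {0..2 * pi}"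
    unfolding circlepath_def by (subst (asm) has_contour_integral_part_circlepath_iff) auto
  also have "(\<lambda>t. h (0 + r * cis t) / (0 + r * cis t - of_real r * w) * r * \<i> * cis t) = (\<lambda>t. \<i> * ?g t)"
  proof
    fix t
    have e: "cis (- t) * cis t = 1" by (simp add: cis_mult)
    have "h (0 + r * cis t) / (0 + r * cis t - of_real r * w) * r * \<i> * cis t = \<i> * h (r * cis t) * (cis t / (cis t - w))"
      using r ne'[of t] by (simp add: field_simps)
    also have "cis t / (cis t - w) = 1 / (1 - w * cis (- t))"
      using ne[of t] ne'[of t] e by (simp add: field_simps)
    finally show "h (0 + r * cis t) / (0 + r * cis t - of_real r * w) * r * \<i> * cis t = \<i> * ?g t"
      by simp
  qed
  finally have g: "((\<lambda>t. \<i> * ?g t) has_integral 2 * of_real pi * \<i> * h (of_real r * w)) {0..2 * pi}" .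
  have ii: "- \<i> * (\<i> * x) = x" for x
    by (simp flip: mult.assoc)
  have "2 * of_real pi * \<i> * h (of_real r * w) = \<i> * (2 * of_real pi * h (of_real r * w))"
    by (simp only: mult_ac)
  then have "(?g has_integral 2 * of_real pi * h (of_real r * w)) {0..2 * pi}"
    using has_integral_mult_right[OF g, of "- \<i>"] by (simp only: ii)
  then have "integral {0..2 * pi} ?g = 2 * of_real pi * h (of_real r * w)"
    by (rule integral_unique)
  then show ?thesis
    unfolding angle_integral[OF cont] by simp
qed

lemma cis_power_mult_cnj: "cis \<theta> ^ n * cnj (cis \<theta> ^ n) = 1"
  unfolding complex_norm_square[symmetric] by (simp add: norm_power)

lemma angle_integral_cis_power:
  assumes "0 < n"
  shows "(LINT \<theta>|angle_measure. cis \<theta> ^ n) = 0"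
proof -
  \<comment> \<open>The case \<open>w = 0\<close> of Cauchy's formula is the mean value property. It
    requires a radius below 1; the value 1/2 is arbitrary, and its power is cancelled at the
    end.\<close>
  have "(LINT \<theta>|angle_measure. (of_real (1/2) * cis \<theta>) ^ n * (1 / (1 - 0 * cis (- \<theta>)))) = (of_real (1/2) * 0) ^ n"
    by (rule angle_Cauchy) (auto intro!: holomorphic_intros)
  also have "(\<lambda>\<theta>. (of_real (1/2) * cis \<theta>) ^ n * (1 / (1 - 0 * cis (- \<theta>)))) = (\<lambda>\<theta>. (1/2) ^ n * cis \<theta> ^ n)"
    by (simp add: power_mult_distrib power_divide)
  finally have "(LINT \<theta>|angle_measure. (1/2) ^ n * cis \<theta> ^ n) = 0"
    using assms by (simp add: power_0_left)
  then show ?thesis by (simp only: integral_mult_right_zero) simp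
qed

lemma cis_power_mult_cnj_less:
  assumes "n < m"
  shows "cis \<theta> ^ m * cnj (cis \<theta> ^ n) = cis \<theta> ^ (m - n)"
proof -
  have "cis \<theta> ^ m = cis \<theta> ^ (m - n) * cis \<theta> ^ n"
    using assms by (simp flip: power_add)
  then show ?thesis
    by (simp only: mult.assoc cis_power_mult_cnj mult_1_right)
qed

lemma angle_orthonormal:
  "(LINT \<theta>|angle_measure. cis \<theta> ^ m * cnj (cis \<theta> ^ n)) = (if m = n then 1 else 0)"
proof (cases m n rule: linorder_cases)
  case equal
  interpret prob_space angle_measure by (rule prob_space_angle_measure)
  show ?thesis unfolding equal cis_power_mult_cnj using prob_space by simp
next
  case greater
  then show ?thesis
    unfolding cis_power_mult_cnj_less[OF greater] by (simp add: angle_integral_cis_power)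
next
  case less
  have "cis \<theta> ^ m * cnj (cis \<theta> ^ n) = cnj (cis \<theta> ^ n * cnj (cis \<theta> ^ m))" for \<theta>
    by (simp only: complex_cnj_mult complex_cnj_cnj mult.commute)
  also have "\<dots> \<theta> = cnj (cis \<theta> ^ (n - m))" for \<theta>
    by (simp only: cis_power_mult_cnj_less[OF less])
  finally have "(LINT \<theta>|angle_measure. cis \<theta> ^ m * cnj (cis \<theta> ^ n)) = cnj (LINT \<theta>|angle_measure. cis \<theta> ^ (n - m))"
    by (simp only: Bochner_Integration.integral_cnj)
  then show ?thesis using less by (simp add: angle_integral_cis_power)
qed

section \<open>The torus as a product of angles\<close>

abbreviation angles_measure :: "('n::finite \<Rightarrow> real) measure" where
  "angles_measure \<equiv> Pi\<^sub>M UNIV (\<lambda>_. angle_measure)"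

definition torus_point :: "('n::finite \<Rightarrow> real) \<Rightarrow> complex ^ 'n" where
  "torus_point \<theta> = (\<chi> j. cis (\<theta> j))"

lemma torus_point_nth [simp]: "torus_point \<theta> $ j = cis (\<theta> j)"
  by (simp add: torus_point_def)

lemma prob_space_angles_measure: "prob_space (Pi\<^sub>M I (\<lambda>_. angle_measure))"
  by (intro prob_space_PiM prob_space_angle_measure)

text \<open>A vector is the finite sum of its components placed by the continuous maps
  \<open>axis i\<close>.\<close>

lemma borel_measurable_vec_lambda:
  fixes g :: "'n::finite \<Rightarrow> 'a \<Rightarrow> complex"
  assumes "\<And>i. g i \<in> borel_measurable M"
  shows "(\<lambda>x. \<chi> i. g i x) \<in> borel_measurable M"
proof -
  have "(\<lambda>x. \<Sum>i\<in>UNIV. axis i (g i x)) \<in> borel_measurable M"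
    using bounded_linear_axis
    by (intro borel_measurable_sum measurable_compose[OF assms] borel_measurable_continuous_onI
        linear_continuous_on)
  also have "(\<lambda>x. \<Sum>i\<in>UNIV. axis i (g i x)) = (\<lambda>x. \<chi> i. g i x)"
    by (auto simp: vec_eq_iff axis_def)
  finally show ?thesis .
qed

lemma borel_measurable_cis [measurable]: "cis \<in> borel_measurable borel"
  by (intro borel_measurable_continuous_onI continuous_intros)

lemma borel_measurable_torus_point [measurable]:
  "torus_point \<in> borel_measurable (angles_measure :: ('n::finite \<Rightarrow> real) measure)"
  unfolding torus_point_def
proof (rule borel_measurable_vec_lambda)
  fix i :: 'n
  have "(\<lambda>\<theta>. \<theta> i) \<in> measurable (angles_measure :: ('n \<Rightarrow> real) measure) angle_measure"
    by (rule measurable_component_singleton) simp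
  then have "(\<lambda>\<theta>. \<theta> i) \<in> borel_measurable (angles_measure :: ('n \<Rightarrow> real) measure)"
    by simp
  from measurable_compose[OF this borel_measurable_cis]
  show "(\<lambda>\<theta>. cis (\<theta> i)) \<in> borel_measurable (angles_measure :: ('n \<Rightarrow> real) measure)" .
qed

lemma integral_torus_measure:
  fixes F :: "complex ^ 'n::finite \<Rightarrow> 'b::{banach, second_countable_topology}"
  assumes "F \<in> borel_measurable borel"
  shows "(LINT \<zeta>|torus_measure. F \<zeta>) = (LINT \<theta>|angles_measure. F (torus_point \<theta>))"
  unfolding torus_measure_def torus_point_def[symmetric]
  by (rule integral_distr[OF borel_measurable_torus_point assms])

text \<open>Outside the polydisk nothing is known about \<open>f\<close>. Multiplying by the
  indicator of the open polydisk gives a Borel function that agrees with \<open>f\<close> along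
  \<open>g\<close>.\<close>

lemma borel_measurable_compose_polydisk:
  fixes f :: "complex ^ 'n::finite \<Rightarrow> complex"
  assumes "continuous_on polydisk f" "g \<in> borel_measurable M" "\<And>x. x \<in> space M \<Longrightarrow> g x \<in> polydisk"
  shows "(\<lambda>x. f (g x)) \<in> borel_measurable M"
proof -
  have "(\<lambda>z. indicator polydisk z *\<^sub>R f z) \<in> borel_measurable borel"
    using assms(1) open_polydisk by (intro borel_measurable_continuous_on_indicator borel_open) auto
  from measurable_compose[OF assms(2) this]
  have "(\<lambda>x. indicator polydisk (g x) *\<^sub>R f (g x)) \<in> borel_measurable M" by simp
  then show ?thesis
    by (rule measurable_cong[THEN iffD1, rotated]) (use assms(3) in auto)
qed

text \<open>Induction on the set \<open>J\<close> of coordinates integrated out, the others being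
  frozen at \<open>z\<close>. Fubini puts the new coordinate \<open>k\<close> innermost, where the
  one-variable formula applies to a slice of \<open>f\<close>. The result has coordinate
  \<open>k\<close> frozen at \<open>r * w k\<close>, so the induction hypothesis is needed at a
  different \<open>z\<close>.\<close>

lemma torus_Cauchy_aux:
  fixes f :: "complex ^ 'n::finite \<Rightarrow> complex"
  assumes f: "analytic_vec_on f polydisk" and r: "0 < r" "r < 1" and w: "\<And>i. norm (w i) < 1"
    and J: "finite J" and z: "z \<in> polydisk"
  shows "(LINT \<theta>|Pi\<^sub>M J (\<lambda>_. angle_measure). f (\<chi> i. if i \<in> J then of_real r * cis (\<theta> i) else z $ i) *
      (\<Prod>i\<in>J. 1 / (1 - w i * cis (- \<theta> i)))) = f (\<chi> i. if i \<in> J then of_real r * w i else z $ i)"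
  using J z
proof (induction J arbitrary: z)
  case empty
  interpret P: prob_space "Pi\<^sub>M ({}::'n set) (\<lambda>_. angle_measure)" by (rule prob_space_angles_measure)
  show ?case using P.prob_space by simp
next
  case (insert k J z)
  interpret product_sigma_finite "\<lambda>_::'n. angle_measure"
    by (intro product_sigma_finite.intro prob_space_imp_sigma_finite prob_space_angle_measure)
  interpret P: prob_space "Pi\<^sub>M (insert k J) (\<lambda>_. angle_measure)" by (rule prob_space_angles_measure)
  let ?p = "\<lambda>\<theta>. \<chi> i. if i \<in> insert k J then of_real r * cis (\<theta> i) else z $ i"
  let ?F = "\<lambda>\<theta>. f (?p \<theta>) * (\<Prod>i\<in>insert k J. 1 / (1 - w i * cis (- \<theta> i)))"
  have cont: "continuous_on polydisk f"
    using f by (rule analytic_vec_on_imp_continuous_on)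
  have p: "?p \<theta> \<in> polydisk" for \<theta>
    using r insert.prems by (auto simp: polydisk_def norm_mult)
  have mp: "?p \<in> borel_measurable (Pi\<^sub>M (insert k J) (\<lambda>_. angle_measure))"
  proof (rule borel_measurable_vec_lambda)
    fix i
    show "(\<lambda>\<theta>. if i \<in> insert k J then of_real r * cis (\<theta> i) else z $ i)
      \<in> borel_measurable (Pi\<^sub>M (insert k J) (\<lambda>_. angle_measure))"
      by (cases "i \<in> insert k J") auto
  qed
  have mF: "?F \<in> borel_measurable (Pi\<^sub>M (insert k J) (\<lambda>_. angle_measure))"
    using insert.hyps(1) borel_measurable_compose_polydisk[OF cont mp p]
    by (intro borel_measurable_times borel_measurable_prod) auto
  define \<rho> where "\<rho> = Max (insert r (range (\<lambda>i. norm (z $ i))))"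
  have \<rho>: "\<rho> < 1" "r \<le> \<rho>" "\<And>i. norm (z $ i) \<le> \<rho>"
    using r insert.prems by (auto simp: \<rho>_def polydisk_def intro!: max.coboundedI2 Max_ge)
  obtain B where B: "B \<ge> 0" "\<And>z. (\<And>i. norm (z $ i) \<le> \<rho>) \<Longrightarrow> norm (f z) \<le> B"
    using continuous_polydisk_bounded[OF cont \<rho>(1)] by metis
  have "norm (?F \<theta>) \<le> B * (\<Prod>i\<in>insert k J. 1 / (1 - norm (w i)))" for \<theta>
    unfolding norm_mult prod_norm[symmetric]
  proof (intro mult_mono prod_mono conjI norm_ge_zero prod_nonneg B(1))
    show "norm (f (?p \<theta>)) \<le> B"
      using r \<rho> by (intro B(2)) (auto simp: norm_mult)
    fix i
    have "1 - norm (w i) \<le> norm (1 - w i * cis (- \<theta> i))"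
      using norm_triangle_ineq2[of 1 "w i * cis (- \<theta> i)"] by (simp add: norm_mult)
    then show "norm (1 / (1 - w i * cis (- \<theta> i))) \<le> 1 / (1 - norm (w i))"
      using w[of i] by (simp add: norm_divide divide_left_mono frac_le)
  qed
  then have int: "integrable (Pi\<^sub>M (insert k J) (\<lambda>_. angle_measure)) ?F"
    using mF by (intro P.integrable_const_bound) auto
  have "integral\<^sup>L (Pi\<^sub>M (insert k J) (\<lambda>_. angle_measure)) ?F =
      (LINT \<theta>|Pi\<^sub>M J (\<lambda>_. angle_measure). LINT t|angle_measure. ?F (\<theta>(k := t)))"
    using insert.hyps int by (intro product_integral_insert) auto
  also have "\<dots> = (LINT \<theta>|Pi\<^sub>M J (\<lambda>_. angle_measure).
      f (\<chi> i. if i \<in> J then of_real r * cis (\<theta> i) else (\<chi> j. if j = k then of_real r * w k else z $ j) $ i) *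
      (\<Prod>i\<in>J. 1 / (1 - w i * cis (- \<theta> i))))"
  proof (rule Bochner_Integration.integral_cong[OF refl])
    fix \<theta> :: "'n \<Rightarrow> real"
    define \<zeta> where "\<zeta> = (\<chi> i. if i \<in> J then of_real r * cis (\<theta> i) else z $ i)"
    let ?h = "\<lambda>u. f (\<chi> j. if j = k then u else \<zeta> $ j)"
    define c where "c = (\<Prod>i\<in>J. 1 / (1 - w i * cis (- \<theta> i)))"
    have "?F (\<theta>(k := t)) = c * (?h (of_real r * cis t) * (1 / (1 - w k * cis (- t))))" for t
    proof -
      have "?p (\<theta>(k := t)) = (\<chi> j. if j = k then of_real r * cis t else \<zeta> $ j)"
        by (auto simp: vec_eq_iff \<zeta>_def)
      moreover have "(\<Prod>i\<in>J. 1 / (1 - w i * cis (- (\<theta>(k := t)) i))) = c"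
        unfolding c_def using insert.hyps(2) by (intro prod.cong) auto
      ultimately show ?thesis using insert.hyps by simp
    qed
    then have "(LINT t|angle_measure. ?F (\<theta>(k := t))) =
        c * (LINT t|angle_measure. ?h (of_real r * cis t) * (1 / (1 - w k * cis (- t))))"
      by (simp only: integral_mult_right_zero)
    also have "(LINT t|angle_measure. ?h (of_real r * cis t) * (1 / (1 - w k * cis (- t)))) = ?h (of_real r * w k)"
    proof (rule angle_Cauchy[OF _ r w])
      show "?h holomorphic_on ball 0 1"
        using r insert.prems
        by (intro analytic_vec_on_slice_holomorphic[OF f]) (auto simp: polydisk_def \<zeta>_def norm_mult)
    qed
    also have "(\<chi> j. if j = k then of_real r * w k else \<zeta> $ j) =
        (\<chi> i. if i \<in> J then of_real r * cis (\<theta> i) else (\<chi> j. if j = k then of_real r * w k else z $ j) $ i)"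
      using insert.hyps(2) by (auto simp: vec_eq_iff \<zeta>_def)
    finally show "(LINT t|angle_measure. ?F (\<theta>(k := t))) =
      f (\<chi> i. if i \<in> J then of_real r * cis (\<theta> i) else (\<chi> j. if j = k then of_real r * w k else z $ j) $ i) *
      (\<Prod>i\<in>J. 1 / (1 - w i * cis (- \<theta> i)))"
      by (simp only: c_def mult.commute)
  qed
  also have "\<dots> = f (\<chi> i. if i \<in> J then of_real r * w i else (\<chi> j. if j = k then of_real r * w k else z $ j) $ i)"
  proof (rule insert.IH)
    have "norm (of_real r * w k) < 1"
      using mult_strict_mono[of r 1 "norm (w k)" 1] r w[of k] by (simp add: norm_mult)
    then show "(\<chi> j. if j = k then of_real r * w k else z $ j) \<in> polydisk"
      using insert.prems by (auto simp: polydisk_def)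
  qed
  also have "(\<chi> i. if i \<in> J then of_real r * w i else (\<chi> j. if j = k then of_real r * w k else z $ j) $ i) =
      (\<chi> i. if i \<in> insert k J then of_real r * w i else z $ i)"
    by (auto simp: vec_eq_iff)
  finally show ?case .
qed

lemma torus_Cauchy:
  fixes f :: "complex ^ 'n::finite \<Rightarrow> complex"
  assumes "analytic_vec_on f polydisk" "0 < r" "r < 1" "w \<in> polydisk"
  shows "(LINT \<theta>|angles_measure. f (r *\<^sub>R torus_point \<theta>) * (\<Prod>i\<in>UNIV. 1 / (1 - w $ i * cis (- \<theta> i)))) = f (r *\<^sub>R w)"
proof -
  have "(\<chi> i. complex_of_real r * cis (\<theta> i)) = r *\<^sub>R torus_point \<theta>" for \<theta> :: "'n \<Rightarrow> real"
    unfolding vec_eq_iff by (simp add: scaleR_conv_of_real[where 'a = complex])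
  moreover have "(\<chi> i. complex_of_real r * w $ i) = r *\<^sub>R w"
    unfolding vec_eq_iff by (simp add: scaleR_conv_of_real[where 'a = complex])
  ultimately show ?thesis
    using torus_Cauchy_aux[OF assms(1-3), of "\<lambda>i. w $ i" UNIV 0] assms(4)
    by (simp add: zero_in_polydisk polydiskD)
qed

section \<open>Power series on the polydisk\<close>

text \<open>The summable majorant makes the finite partial sums converge uniformly, and on a
  probability space a uniform error of e/2 bounds the error of the integrals.\<close>

lemma (in prob_space) has_sum_integral:
  fixes F :: "'i \<Rightarrow> 'a \<Rightarrow> complex"
  assumes F: "\<And>i. F i \<in> borel_measurable M" and S: "S \<in> borel_measurable M"
    and sums: "\<And>x. x \<in> space M \<Longrightarrow> ((\<lambda>i. F i x) has_sum S x) I"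
    and le: "\<And>i x. x \<in> space M \<Longrightarrow> norm (F i x) \<le> B i" and B: "B summable_on I"
  shows "((\<lambda>i. LINT x|M. F i x) has_sum (LINT x|M. S x)) I"
  unfolding has_sum_def
proof (rule tendstoI)
  fix e :: real assume e: "0 < e"
  have iF: "integrable M (F i)" for i
    using F le by (intro integrable_const_bound[of _ "B i"]) auto
  have "uniform_limit (space M) (\<lambda>X x. \<Sum>i\<in>X. F i x) S (finite_subsets_at_top I)"
    by (rule Weierstrass_m_test_general'[OF _ sums B]) (use le in auto)
  then have "\<forall>\<^sub>F X in finite_subsets_at_top I. \<forall>x\<in>space M. dist (\<Sum>i\<in>X. F i x) (S x) < e / 2"
    by (rule uniform_limitD) (use e in simp)
  then show "\<forall>\<^sub>F X in finite_subsets_at_top I. dist (\<Sum>i\<in>X. LINT x|M. F i x) (LINT x|M. S x) < e"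
  proof eventually_elim
    case (elim X)
    let ?D = "\<lambda>x. (\<Sum>i\<in>X. F i x) - S x"
    have le: "norm (?D x) \<le> e / 2" if "x \<in> space M" for x
      using elim that by (auto simp: dist_norm intro: less_imp_le)
    have iD: "integrable M ?D"
      using F S le by (intro integrable_const_bound[of _ "e / 2"]) auto
    \<comment> \<open>\<open>S\<close> is a finite sum of integrable functions minus the bounded
      difference \<open>?D\<close>.\<close>
    have iS: "integrable M S"
      using Bochner_Integration.integrable_diff[OF Bochner_Integration.integrable_sum[of X M F, OF iF] iD] by simp
    have "(\<Sum>i\<in>X. LINT x|M. F i x) - (LINT x|M. S x) = (LINT x|M. ?D x)"
      using iF iS by simp
    also have "norm \<dots> \<le> (LINT x|M. norm (?D x))"
      by (rule integral_norm_bound)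
    also have "\<dots> \<le> e / 2"
      using iD le by (intro integral_le_const) auto
    finally show ?case using e by (simp add: dist_norm)
  qed
qed

text \<open>A finite set of multi-indices lies in the box spanned by its projections
  \<open>N i\<close>. Over a box the sum of products factors into a product of sums, each of which
  is at most the full one-variable sum.\<close>

lemma summable_on_prod_coordinates:
  fixes g :: "'n::finite \<Rightarrow> nat \<Rightarrow> complex"
  assumes "\<And>i. (\<lambda>m. norm (g i m)) summable_on UNIV"
  shows "(\<lambda>\<alpha>. norm (\<Prod>i\<in>UNIV. g i (\<alpha> i))) summable_on UNIV"
proof (rule nonneg_bounded_partial_sums_imp_summable_on)
  show "\<forall>\<^sub>F F in finite_subsets_at_top UNIV.
      (\<Sum>\<alpha>\<in>F. norm (\<Prod>i\<in>UNIV. g i (\<alpha> i))) \<le> (\<Prod>i\<in>UNIV. \<Sum>\<^sub>\<infinity>m. norm (g i m))"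
  proof (rule eventually_finite_subsets_at_top_weakI)
    fix F :: "('n \<Rightarrow> nat) set" assume F: "finite F"
    define N where "N i = (\<lambda>\<alpha>. \<alpha> i) ` F" for i
    have N: "finite (N i)" for i using F by (simp add: N_def)
    have "(\<Sum>\<alpha>\<in>F. norm (\<Prod>i\<in>UNIV. g i (\<alpha> i))) = (\<Sum>\<alpha>\<in>F. \<Prod>i\<in>UNIV. norm (g i (\<alpha> i)))"
      by (simp add: prod_norm)
    also have "\<dots> \<le> (\<Sum>\<alpha>\<in>PiE UNIV N. \<Prod>i\<in>UNIV. norm (g i (\<alpha> i)))"
      using N by (intro sum_mono2 finite_PiE prod_nonneg) (auto simp: N_def)
    also have "\<dots> = (\<Prod>i\<in>UNIV. \<Sum>m\<in>N i. norm (g i m))"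
      using N by (subst prod_sum_PiE) auto
    also have "\<dots> \<le> (\<Prod>i\<in>UNIV. \<Sum>\<^sub>\<infinity>m. norm (g i m))"
      using N assms by (intro prod_mono conjI sum_nonneg finite_sum_le_infsum) auto
    finally show "(\<Sum>\<alpha>\<in>F. norm (\<Prod>i\<in>UNIV. g i (\<alpha> i))) \<le> (\<Prod>i\<in>UNIV. \<Sum>\<^sub>\<infinity>m. norm (g i m))" .
  qed
qed auto

lemma has_sum_prod_coordinates:
  fixes g :: "'n::finite \<Rightarrow> nat \<Rightarrow> complex"
  assumes "\<And>i. (\<lambda>m. norm (g i m)) summable_on UNIV" "\<And>i. (g i has_sum s i) UNIV"
  shows "((\<lambda>\<alpha>. \<Prod>i\<in>UNIV. g i (\<alpha> i)) has_sum (\<Prod>i\<in>UNIV. s i)) UNIV"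
proof -
  have "(\<lambda>\<alpha>. \<Prod>i\<in>UNIV. g i (\<alpha> i)) summable_on UNIV"
    by (rule abs_summable_summable[OF summable_on_prod_coordinates[OF assms(1)]])
  moreover have "(\<Sum>\<^sub>\<infinity>\<alpha>. \<Prod>i\<in>UNIV. g i (\<alpha> i)) = (\<Prod>i\<in>UNIV. s i)"
    using infsum_prod_PiE_abs[of UNIV g "\<lambda>_. UNIV"] assms(1) infsumI[OF assms(2)] by simp
  ultimately show ?thesis by (metis has_sum_infsum)
qed

abbreviation multi_degree :: "('n::finite \<Rightarrow> nat) \<Rightarrow> nat" where
  "multi_degree \<alpha> \<equiv> sum \<alpha> UNIV"

definition vmonom :: "('n::finite \<Rightarrow> nat) \<Rightarrow> complex ^ 'n \<Rightarrow> complex" where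
  "vmonom \<alpha> z = (\<Prod>i\<in>UNIV. z $ i ^ \<alpha> i)"

lemma vmonom_scaleR: "vmonom \<alpha> (r *\<^sub>R z) = of_real r ^ multi_degree \<alpha> * vmonom \<alpha> z"
  by (simp add: vmonom_def scaleR_conv_of_real[where 'a = complex] power_mult_distrib prod.distrib power_sum)

lemma norm_vmonom_le:
  assumes "\<And>i. norm (z $ i) \<le> r"
  shows "norm (vmonom \<alpha> z) \<le> r ^ multi_degree \<alpha>"
  unfolding vmonom_def power_sum prod_norm[symmetric]
  by (intro prod_mono) (simp add: norm_power power_mono assms)

lemma norm_vmonom_torus [simp]: "norm (vmonom \<alpha> (torus_point \<theta>)) = 1"
  by (simp add: vmonom_def norm_power flip: prod_norm)

lemma analytic_vec_on_vmonom: "analytic_vec_on (vmonom \<alpha>) S"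
proof -
  have "analytic_vec_on (\<lambda>z. z $ i ^ \<alpha> i) S" for i
    by (rule analytic_vec_on_compose_holomorphic[OF analytic_vec_on_nth, of "\<lambda>w. w ^ \<alpha> i" UNIV])
      (auto intro!: holomorphic_intros)
  then show ?thesis unfolding vmonom_def[abs_def] by (intro analytic_vec_on_prod)
qed

lemma borel_measurable_vmonom [measurable]: "vmonom \<alpha> \<in> borel_measurable borel"
  by (intro borel_measurable_continuous_onI analytic_vec_on_imp_continuous_on analytic_vec_on_vmonom)

lemma borel_measurable_vmonom_torus:
  "(\<lambda>\<theta>. vmonom \<alpha> (torus_point \<theta>)) \<in> borel_measurable (angles_measure :: ('n::finite \<Rightarrow> real) measure)"
  by (rule measurable_compose[OF borel_measurable_torus_point borel_measurable_vmonom])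

lemma borel_measurable_cnj:
  assumes "f \<in> borel_measurable M"
  shows "(\<lambda>x. cnj (f x)) \<in> borel_measurable M"
  by (rule measurable_compose[OF assms borel_measurable_continuous_onI]) (intro continuous_intros)

lemma geometric_has_sum:
  assumes "norm (x :: complex) < 1"
  shows "((\<lambda>m. x ^ m) has_sum 1 / (1 - x)) UNIV"
proof -
  have "summable (\<lambda>m. norm (x ^ m))"
    using assms by (simp add: norm_power)
  then show ?thesis
    using geometric_sums[OF assms] by (rule norm_summable_imp_has_sum)
qed

lemma geometric_norm_summable_on:
  assumes "norm (x :: complex) < 1"
  shows "(\<lambda>m. norm (x ^ m)) summable_on UNIV"
  using has_sum_imp_summable[OF geometric_has_sum[OF assms]]
  by (simp only: summable_on_iff_abs_summable_on_complex)

text \<open>A product of geometric series: this is the expansion of the Cauchy kernel of the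
  torus.\<close>

lemma vmonom_has_sum:
  assumes "z \<in> polydisk"
  shows "((\<lambda>\<alpha>. vmonom \<alpha> z) has_sum (\<Prod>i\<in>UNIV. 1 / (1 - z $ i))) UNIV"
  unfolding vmonom_def
  by (intro has_sum_prod_coordinates geometric_has_sum geometric_norm_summable_on polydiskD assms)

lemma vmonom_norm_summable_on:
  assumes "z \<in> polydisk"
  shows "(\<lambda>\<alpha>. norm (vmonom \<alpha> z)) summable_on UNIV"
  unfolding vmonom_def
  by (intro summable_on_prod_coordinates geometric_norm_summable_on polydiskD assms)

lemma vmonom_orthonormal:
  "(LINT \<theta>|angles_measure. vmonom \<alpha> (torus_point \<theta>) * cnj (vmonom \<beta> (torus_point \<theta>))) =
    (if \<alpha> = (\<beta> :: 'n::finite \<Rightarrow> nat) then 1 else 0)"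
proof -
  interpret product_sigma_finite "\<lambda>_::'n. angle_measure"
    by (intro product_sigma_finite.intro prob_space_imp_sigma_finite prob_space_angle_measure)
  interpret P: prob_space angle_measure by (rule prob_space_angle_measure)
  have "(LINT \<theta>|angles_measure. vmonom \<alpha> (torus_point \<theta>) * cnj (vmonom \<beta> (torus_point \<theta>))) =
     (LINT \<theta>|angles_measure. (\<Prod>i\<in>UNIV. cis (\<theta> i) ^ \<alpha> i * cnj (cis (\<theta> i) ^ \<beta> i)))"
    by (simp add: vmonom_def prod.distrib)
  also have "\<dots> = (\<Prod>i\<in>UNIV. LINT t|angle_measure. cis t ^ \<alpha> i * cnj (cis t ^ \<beta> i))"
  proof (intro product_integral_prod)
    fix i :: 'n
    have "(\<lambda>t. cis t ^ \<alpha> i * cnj (cis t ^ \<beta> i)) \<in> borel_measurable borel"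
      by (intro borel_measurable_continuous_onI continuous_intros)
    then show "integrable angle_measure (\<lambda>t. cis t ^ \<alpha> i * cnj (cis t ^ \<beta> i))"
      by (intro P.integrable_const_bound[of _ 1]) (auto simp: norm_mult norm_power)
  qed simp
  also have "\<dots> = (\<Prod>i\<in>UNIV. if \<alpha> i = \<beta> i then 1 else 0)"
    by (simp only: angle_orthonormal)
  also have "\<dots> = (if \<alpha> = \<beta> then 1 else 0)"
    by (auto simp: fun_eq_iff)
  finally show ?thesis .
qed

section \<open>Power series: convergence, coefficients and uniqueness\<close>

text \<open>Summation is unordered, so multi-indices need no enumeration. For complex terms
  unordered summability is absolute summability, and the uniform bounds on smaller polydisks follow
  from this pointwise condition.\<close>

definition has_power_series :: "(complex ^ 'n::finite \<Rightarrow> complex) \<Rightarrow> (('n \<Rightarrow> nat) \<Rightarrow> complex) \<Rightarrow> bool" where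
  "has_power_series f a \<longleftrightarrow> (\<forall>z\<in>polydisk. ((\<lambda>\<alpha>. a \<alpha> * vmonom \<alpha> z) has_sum f z) UNIV)"

lemma has_power_seriesD:
  "has_power_series f a \<Longrightarrow> z \<in> polydisk \<Longrightarrow> ((\<lambda>\<alpha>. a \<alpha> * vmonom \<alpha> z) has_sum f z) UNIV"
  by (simp add: has_power_series_def)

lemma has_power_series_norm_summable_on:
  assumes "has_power_series f a" "0 \<le> r" "r < 1"
  shows "(\<lambda>\<alpha>. norm (a \<alpha>) * r ^ multi_degree \<alpha>) summable_on UNIV"
proof -
  \<comment> \<open>At the diagonal point with all coordinates \<open>r\<close>, the monomial of
    index \<alpha> equals \<open>r ^ multi_degree \<alpha>\<close>.\<close>
  define z :: "complex ^ 'a" where "z = (\<chi> i. of_real r)"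
  have "z \<in> polydisk" using assms by (simp add: z_def polydisk_def)
  from has_sum_imp_summable[OF has_power_seriesD[OF assms(1) this]]
  have "(\<lambda>\<alpha>. norm (a \<alpha> * vmonom \<alpha> z)) summable_on UNIV"
    by (simp only: summable_on_iff_abs_summable_on_complex)
  also have "(\<lambda>\<alpha>. norm (a \<alpha> * vmonom \<alpha> z)) = (\<lambda>\<alpha>. norm (a \<alpha>) * r ^ multi_degree \<alpha>)"
    using assms by (simp add: vmonom_def z_def norm_mult norm_power power_sum flip: prod_norm)
  finally show ?thesis .
qed

lemma has_power_series_uniform_limit:
  assumes "has_power_series f a" "0 \<le> r" "r < 1"
  shows "uniform_limit {z. \<forall>i. norm (z $ i) \<le> r} (\<lambda>X z. \<Sum>\<alpha>\<in>X. a \<alpha> * vmonom \<alpha> z) f (finite_subsets_at_top UNIV)"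
proof (rule Weierstrass_m_test_general'[OF _ _ has_power_series_norm_summable_on[OF assms]])
  fix \<alpha> and z :: "complex ^ 'a" assume "z \<in> {z. \<forall>i. norm (z $ i) \<le> r}"
  then show "norm (a \<alpha> * vmonom \<alpha> z) \<le> norm (a \<alpha>) * r ^ multi_degree \<alpha>"
    unfolding norm_mult by (intro mult_left_mono norm_vmonom_le) auto
next
  fix z :: "complex ^ 'a" assume "z \<in> {z. \<forall>i. norm (z $ i) \<le> r}"
  then show "((\<lambda>\<alpha>. a \<alpha> * vmonom \<alpha> z) has_sum f z) UNIV"
    using assms by (intro has_power_seriesD[OF assms(1)]) (auto simp: polydisk_def intro: le_less_trans)
qed

lemma polydisk_radius:
  assumes "z \<in> polydisk"
  obtains r :: real where "0 < r" "r < 1" "\<And>i. norm (z $ i) < r"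
proof -
  define m where "m = Max (insert 0 (range (\<lambda>i. norm (z $ i))))"
  have m: "0 \<le> m" "m < 1" "\<And>i. norm (z $ i) \<le> m"
    using assms by (auto simp: m_def polydisk_def intro!: max.coboundedI2 Max_ge)
  obtain r where "m < r" "r < 1" using m(2) dense by blast
  then show thesis using m by (intro that[of r]) (auto intro: le_less_trans)
qed

lemma has_power_series_continuous_on:
  assumes "has_power_series f a"
  shows "continuous_on polydisk f"
proof (rule continuous_at_imp_continuous_on, rule ballI)
  fix z :: "complex ^ 'a" assume "z \<in> polydisk"
  then obtain r where r: "0 < r" "r < 1" "\<And>i. norm (z $ i) < r"
    by (rule polydisk_radius) blast
  have "continuous_on {z :: complex ^ 'a. \<forall>i. norm (z $ i) \<le> r} f"
    by (rule uniform_limit_theorem[OF _ has_power_series_uniform_limit[OF assms]])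
      (use r in \<open>auto intro!: always_eventually continuous_on_sum continuous_on_mult continuous_on_const analytic_vec_on_imp_continuous_on[OF analytic_vec_on_vmonom]\<close>)
  then have "continuous_on (\<Inter>i\<in>UNIV. {z :: complex ^ 'a. norm (z $ i) < r}) f"
    by (rule continuous_on_subset) (auto intro: less_imp_le)
  moreover have "open (\<Inter>i\<in>UNIV. {z :: complex ^ 'a. norm (z $ i) < r})"
    by (intro open_INT finite ballI open_Collect_less continuous_intros)
  ultimately show "isCont f z"
    using r(3) by (simp add: continuous_on_eq_continuous_at)
qed

lemma scaleR_torus_in_polydisk: "0 \<le> r \<Longrightarrow> r < 1 \<Longrightarrow> r *\<^sub>R torus_point \<theta> \<in> polydisk"
  by (simp add: polydisk_def)

lemma borel_measurable_on_torus:
  fixes f :: "complex ^ 'n::finite \<Rightarrow> complex"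
  assumes "continuous_on polydisk f" "0 \<le> r" "r < 1"
  shows "(\<lambda>\<theta>. f (r *\<^sub>R torus_point \<theta>)) \<in> borel_measurable angles_measure"
  by (rule borel_measurable_compose_polydisk[OF assms(1)])
    (use assms in \<open>auto intro!: scaleR_torus_in_polydisk\<close>)

lemmas torus_measurable_intros = borel_measurable_times borel_measurable_cnj borel_measurable_const
  borel_measurable_vmonom_torus borel_measurable_on_torus

lemma bounded_on_torus:
  fixes f :: "complex ^ 'n::finite \<Rightarrow> complex"
  assumes "continuous_on polydisk f" "0 \<le> r" "r < 1"
  obtains B where "0 \<le> B" "\<And>\<theta>. norm (f (r *\<^sub>R torus_point \<theta>)) \<le> B"
proof -
  obtain B where "0 \<le> B" "\<And>z :: complex ^ 'n. (\<And>i. norm (z $ i) \<le> r) \<Longrightarrow> norm (f z) \<le> B"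
    using continuous_polydisk_bounded[OF assms(1,3)] by metis
  then show thesis using assms by (intro that[of B]) auto
qed

text \<open>Only \<open>g\<close> is expanded, while \<open>f\<close> enters through its Fourier
  integrals on the torus. For an \<open>f\<close> with a power series these integrals are evaluated
  by \<open>power_series_coefficient\<close>.\<close>

lemma Parseval:
  fixes f g :: "complex ^ 'n::finite \<Rightarrow> complex"
  assumes f: "continuous_on polydisk f" and g: "has_power_series g b" and r: "0 \<le> r" "r < 1"
  shows "((\<lambda>\<beta>. of_real r ^ multi_degree \<beta> * cnj (b \<beta>) *
            (LINT \<theta>|angles_measure. f (r *\<^sub>R torus_point \<theta>) * cnj (vmonom \<beta> (torus_point \<theta>))))
     has_sum (LINT \<theta>|angles_measure. f (r *\<^sub>R torus_point \<theta>) * cnj (g (r *\<^sub>R torus_point \<theta>)))) UNIV"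
proof -
  interpret P: prob_space "angles_measure :: ('n \<Rightarrow> real) measure" by (rule prob_space_angles_measure)
  obtain C where C: "0 \<le> C" "\<And>\<theta>. norm (f (r *\<^sub>R torus_point \<theta>)) \<le> C"
    using bounded_on_torus[OF f r] by metis
  have "((\<lambda>\<beta>. LINT \<theta>|angles_measure. f (r *\<^sub>R torus_point \<theta>) * cnj (b \<beta> * vmonom \<beta> (r *\<^sub>R torus_point \<theta>)))
     has_sum (LINT \<theta>|angles_measure. f (r *\<^sub>R torus_point \<theta>) * cnj (g (r *\<^sub>R torus_point \<theta>)))) UNIV"
  proof (rule P.has_sum_integral)
    show "((\<lambda>\<beta>. f (r *\<^sub>R torus_point \<theta>) * cnj (b \<beta> * vmonom \<beta> (r *\<^sub>R torus_point \<theta>))) has_sum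
        f (r *\<^sub>R torus_point \<theta>) * cnj (g (r *\<^sub>R torus_point \<theta>))) UNIV" for \<theta>
      by (intro has_sum_cmult_right has_sum_cnj_iff[THEN iffD2] has_power_seriesD[OF g] scaleR_torus_in_polydisk r)
    show "norm (f (r *\<^sub>R torus_point \<theta>) * cnj (b \<beta> * vmonom \<beta> (r *\<^sub>R torus_point \<theta>)))
        \<le> C * (norm (b \<beta>) * r ^ multi_degree \<beta>)" for \<beta> \<theta>
      unfolding norm_mult complex_mod_cnj vmonom_scaleR
      using r by (intro mult_mono C) (auto simp: norm_mult norm_power)
    show "(\<lambda>\<beta>. C * (norm (b \<beta>) * r ^ multi_degree \<beta>)) summable_on UNIV"
      by (intro summable_on_cmult_right has_power_series_norm_summable_on[OF g] r)
    show "(\<lambda>\<theta>. f (r *\<^sub>R torus_point \<theta>) * cnj (g (r *\<^sub>R torus_point \<theta>))) \<in> borel_measurable angles_measure"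
      by (intro torus_measurable_intros f has_power_series_continuous_on[OF g] r)
    show "(\<lambda>\<theta>. f (r *\<^sub>R torus_point \<theta>) * cnj (b \<beta> * vmonom \<beta> (r *\<^sub>R torus_point \<theta>)))
       \<in> borel_measurable angles_measure" for \<beta>
      unfolding vmonom_scaleR by (intro torus_measurable_intros f r)
  qed
  moreover have "(LINT \<theta>|angles_measure. f (r *\<^sub>R torus_point \<theta>) * cnj (b \<beta> * vmonom \<beta> (r *\<^sub>R torus_point \<theta>))) =
     of_real r ^ multi_degree \<beta> * cnj (b \<beta>) *
            (LINT \<theta>|angles_measure. f (r *\<^sub>R torus_point \<theta>) * cnj (vmonom \<beta> (torus_point \<theta>)))" for \<beta>
    unfolding integral_mult_right_zero[symmetric]
    by (rule Bochner_Integration.integral_cong[OF refl]) (simp add: vmonom_scaleR mult_ac)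
  ultimately show ?thesis by simp
qed

lemma has_power_series_cong:
  "has_power_series f a \<Longrightarrow> (\<And>z. z \<in> polydisk \<Longrightarrow> f z = g z) \<Longrightarrow> has_power_series g a"
  by (simp add: has_power_series_def)

lemma has_power_series_sum_vmonom:
  assumes "finite A"
  shows "has_power_series (\<lambda>z. \<Sum>\<alpha>\<in>A. b \<alpha> * vmonom \<alpha> z) (\<lambda>\<alpha>. if \<alpha> \<in> A then b \<alpha> else 0)"
  unfolding has_power_series_def
proof
  fix z
  have "((\<lambda>\<alpha>. b \<alpha> * vmonom \<alpha> z) has_sum (\<Sum>\<alpha>\<in>A. b \<alpha> * vmonom \<alpha> z)) A"
    using assms by (rule has_sum_finite)
  then show "((\<lambda>\<alpha>. (if \<alpha> \<in> A then b \<alpha> else 0) * vmonom \<alpha> z) has_sum (\<Sum>\<alpha>\<in>A. b \<alpha> * vmonom \<alpha> z)) UNIV"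
    by (rule has_sum_cong_neutral[THEN iffD1, rotated 3]) auto
qed

lemma has_power_series_vmonom: "has_power_series (vmonom \<beta>) (\<lambda>\<alpha>. if \<alpha> = \<beta> then 1 else 0)"
  using has_power_series_sum_vmonom[of "{\<beta>}" "\<lambda>_. 1"] by simp

text \<open>Termwise integration against a monomial leaves a single term by orthonormality. Since
  the left side depends on \<open>f\<close> alone, any positive radius recovers the coefficients,
  which yields uniqueness.\<close>

lemma power_series_coefficient:
  fixes f :: "complex ^ 'n::finite \<Rightarrow> complex"
  assumes f: "has_power_series f a" and r: "0 \<le> r" "r < 1"
  shows "(LINT \<theta>|angles_measure. f (r *\<^sub>R torus_point \<theta>) * cnj (vmonom \<beta> (torus_point \<theta>))) =
     of_real r ^ multi_degree \<beta> * a \<beta>"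
proof -
  interpret P: prob_space "angles_measure :: ('n \<Rightarrow> real) measure" by (rule prob_space_angles_measure)
  have "((\<lambda>\<alpha>. LINT \<theta>|angles_measure. a \<alpha> * vmonom \<alpha> (r *\<^sub>R torus_point \<theta>) * cnj (vmonom \<beta> (torus_point \<theta>)))
     has_sum (LINT \<theta>|angles_measure. f (r *\<^sub>R torus_point \<theta>) * cnj (vmonom \<beta> (torus_point \<theta>)))) UNIV"
  proof (rule P.has_sum_integral)
    show "((\<lambda>\<alpha>. a \<alpha> * vmonom \<alpha> (r *\<^sub>R torus_point \<theta>) * cnj (vmonom \<beta> (torus_point \<theta>))) has_sum
        f (r *\<^sub>R torus_point \<theta>) * cnj (vmonom \<beta> (torus_point \<theta>))) UNIV" for \<theta>
      by (intro has_sum_cmult_left has_power_seriesD[OF f] scaleR_torus_in_polydisk r)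
    show "norm (a \<alpha> * vmonom \<alpha> (r *\<^sub>R torus_point \<theta>) * cnj (vmonom \<beta> (torus_point \<theta>)))
        \<le> norm (a \<alpha>) * r ^ multi_degree \<alpha>" for \<alpha> \<theta>
      using r by (simp add: vmonom_scaleR norm_mult norm_power)
    show "(\<lambda>\<alpha>. norm (a \<alpha>) * r ^ multi_degree \<alpha>) summable_on UNIV"
      by (intro has_power_series_norm_summable_on[OF f] r)
  qed (unfold vmonom_scaleR, (intro torus_measurable_intros has_power_series_continuous_on[OF f] r)+)
  moreover have "(LINT \<theta>|angles_measure. a \<alpha> * vmonom \<alpha> (r *\<^sub>R torus_point \<theta>) * cnj (vmonom \<beta> (torus_point \<theta>))) =
     (if \<alpha> = \<beta> then of_real r ^ multi_degree \<beta> * a \<beta> else 0)" for \<alpha>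
  proof -
    have "(LINT \<theta>|angles_measure. a \<alpha> * vmonom \<alpha> (r *\<^sub>R torus_point \<theta>) * cnj (vmonom \<beta> (torus_point \<theta>))) =
       (LINT \<theta>|angles_measure. of_real r ^ multi_degree \<alpha> * a \<alpha> * (vmonom \<alpha> (torus_point \<theta>) * cnj (vmonom \<beta> (torus_point \<theta>))))"
      by (rule Bochner_Integration.integral_cong[OF refl]) (simp add: vmonom_scaleR mult_ac)
    also have "\<dots> = (if \<alpha> = \<beta> then of_real r ^ multi_degree \<beta> * a \<beta> else 0)"
      unfolding integral_mult_right_zero vmonom_orthonormal by simp
    finally show ?thesis .
  qed
  moreover have "((\<lambda>\<alpha>. if \<alpha> = \<beta> then of_real r ^ multi_degree \<beta> * a \<beta> else 0) has_sum (of_real r ^ multi_degree \<beta> * a \<beta>)) UNIV"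
    by (rule has_sum_finite_neutralI[of "{\<beta>}"]) auto
  ultimately show ?thesis by (simp add: has_sum_unique)
qed

lemma has_power_series_unique:
  assumes "has_power_series f a" "has_power_series f b"
  shows "a = b"
proof
  fix \<beta>
  have "of_real (1/2) ^ multi_degree \<beta> * a \<beta> = of_real (1/2) ^ multi_degree \<beta> * b \<beta>"
    using power_series_coefficient[OF assms(1), of "1/2" \<beta>] power_series_coefficient[OF assms(2), of "1/2" \<beta>]
    by simp
  then show "a \<beta> = b \<beta>" by simp
qed

lemma has_power_series_scaleR:
  assumes "has_power_series f a" "0 \<le> r" "r \<le> 1"
  shows "has_power_series (\<lambda>z. f (r *\<^sub>R z)) (\<lambda>\<alpha>. of_real r ^ multi_degree \<alpha> * a \<alpha>)"
  unfolding has_power_series_def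
proof
  fix z :: "complex ^ 'a" assume "z \<in> polydisk"
  then have "r *\<^sub>R z \<in> polydisk"
    using assms by (auto simp: polydisk_def intro: le_less_trans[OF mult_left_le_one_le])
  from has_power_seriesD[OF assms(1) this]
  show "((\<lambda>\<alpha>. of_real r ^ multi_degree \<alpha> * a \<alpha> * vmonom \<alpha> z) has_sum f (r *\<^sub>R z)) UNIV"
    by (simp add: vmonom_scaleR mult_ac)
qed

text \<open>The Cauchy kernel in the torus formula is expanded and integrated term by term. The
  torus of integration must lie inside the polydisk, so the expansion is one of the dilation by
  \<open>r\<close>, with coefficients that still depend on \<open>r\<close>.\<close>

lemma analytic_dilation_power_series:
  fixes f :: "complex ^ 'n::finite \<Rightarrow> complex"
  assumes f: "analytic_vec_on f polydisk" and r: "0 < r" "r < 1"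
  shows "has_power_series (\<lambda>w. f (r *\<^sub>R w))
     (\<lambda>\<alpha>. LINT \<theta>|angles_measure. f (r *\<^sub>R torus_point \<theta>) * cnj (vmonom \<alpha> (torus_point \<theta>)))"
  unfolding has_power_series_def
proof
  fix w :: "complex ^ 'n" assume w: "w \<in> polydisk"
  interpret P: prob_space "angles_measure :: ('n \<Rightarrow> real) measure" by (rule prob_space_angles_measure)
  have f': "continuous_on polydisk f" using f by (rule analytic_vec_on_imp_continuous_on)
  have r': "0 \<le> r" using r by simp
  obtain C where C: "0 \<le> C" "\<And>\<theta>. norm (f (r *\<^sub>R torus_point \<theta>)) \<le> C"
    using bounded_on_torus[OF f' r' r(2)] by metis
  have eq: "vmonom \<alpha> (\<chi> i. w $ i * cis (- \<theta> i)) = cnj (vmonom \<alpha> (torus_point \<theta>)) * vmonom \<alpha> w" for \<alpha> \<theta>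
    by (simp add: vmonom_def power_mult_distrib prod.distrib cis_cnj)
  have "((\<lambda>\<alpha>. LINT \<theta>|angles_measure. f (r *\<^sub>R torus_point \<theta>) * (cnj (vmonom \<alpha> (torus_point \<theta>)) * vmonom \<alpha> w)) has_sum
    (LINT \<theta>|angles_measure. f (r *\<^sub>R torus_point \<theta>) * (\<Prod>i\<in>UNIV. 1 / (1 - w $ i * cis (- \<theta> i))))) UNIV"
  proof (rule P.has_sum_integral)
    fix \<theta> :: "'n \<Rightarrow> real"
    have "(\<chi> i. w $ i * cis (- \<theta> i)) \<in> polydisk"
      using w by (simp add: polydisk_def norm_mult)
    from vmonom_has_sum[OF this]
    show "((\<lambda>\<alpha>. f (r *\<^sub>R torus_point \<theta>) * (cnj (vmonom \<alpha> (torus_point \<theta>)) * vmonom \<alpha> w)) has_sum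
      f (r *\<^sub>R torus_point \<theta>) * (\<Prod>i\<in>UNIV. 1 / (1 - w $ i * cis (- \<theta> i)))) UNIV"
      unfolding eq by (intro has_sum_cmult_right) simp
    show "norm (f (r *\<^sub>R torus_point \<theta>) * (cnj (vmonom \<alpha> (torus_point \<theta>)) * vmonom \<alpha> w)) \<le> C * norm (vmonom \<alpha> w)" for \<alpha>
      unfolding norm_mult by (intro mult_mono C) auto
  next
    show "(\<lambda>\<alpha>. C * norm (vmonom \<alpha> w)) summable_on UNIV"
      by (intro summable_on_cmult_right vmonom_norm_summable_on w)
    have "(\<lambda>\<theta>. \<Prod>i\<in>UNIV. 1 / (1 - w $ i * cis (- \<theta> i))) \<in> borel_measurable (angles_measure :: ('n \<Rightarrow> real) measure)"
      by (intro borel_measurable_prod borel_measurable_divide borel_measurable_diff) measurable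
    then show "(\<lambda>\<theta>. f (r *\<^sub>R torus_point \<theta>) * (\<Prod>i\<in>UNIV. 1 / (1 - w $ i * cis (- \<theta> i)))) \<in> borel_measurable angles_measure"
      by (intro torus_measurable_intros f' r' r)
  qed (intro torus_measurable_intros f' r' r)
  then have "((\<lambda>\<alpha>. LINT \<theta>|angles_measure. f (r *\<^sub>R torus_point \<theta>) * (cnj (vmonom \<alpha> (torus_point \<theta>)) * vmonom \<alpha> w)) has_sum
    f (r *\<^sub>R w)) UNIV"
    by (simp only: torus_Cauchy[OF f r w])
  then show "((\<lambda>\<alpha>. (LINT \<theta>|angles_measure. f (r *\<^sub>R torus_point \<theta>) * cnj (vmonom \<alpha> (torus_point \<theta>))) * vmonom \<alpha> w) has_sum f (r *\<^sub>R w)) UNIV"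
    by (simp only: mult.assoc[symmetric] integral_mult_left_zero)
qed

text \<open>The expansions of all dilations are glued to one series. Dilating a dilation multiplies
  coefficients by powers of the ratio, so by uniqueness
  \<open>c r \<alpha> / r ^ multi_degree \<alpha>\<close> does not depend on \<open>r\<close>. The
  coefficient of \<open>f\<close> is this quotient, read off at \<open>r = 1/2\<close>.\<close>

theorem analytic_has_power_series:
  fixes f :: "complex ^ 'n::finite \<Rightarrow> complex"
  assumes f: "analytic_vec_on f polydisk"
  obtains a where "has_power_series f a"
proof
  define c where "c r \<alpha> = (LINT \<theta>|angles_measure. f (r *\<^sub>R torus_point \<theta>) * cnj (vmonom \<alpha> (torus_point \<theta>)))"
    for r and \<alpha> :: "'n \<Rightarrow> nat"
  have c: "has_power_series (\<lambda>w. f (r *\<^sub>R w)) (c r)" if "0 < r" "r < 1" for r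
    unfolding c_def[abs_def] using f that by (rule analytic_dilation_power_series)
  have scale: "c (r * s) = (\<lambda>\<alpha>. of_real s ^ multi_degree \<alpha> * c r \<alpha>)" if "0 < r" "r < 1" "0 < s" "s < 1" for r s
  proof (rule has_power_series_unique)
    show "has_power_series (\<lambda>w. f ((r * s) *\<^sub>R w)) (c (r * s))"
      using that by (intro c) (use mult_strict_mono[of r 1 s 1] in auto)
    show "has_power_series (\<lambda>w. f ((r * s) *\<^sub>R w)) (\<lambda>\<alpha>. of_real s ^ multi_degree \<alpha> * c r \<alpha>)"
      using has_power_series_scaleR[OF c[of r], of s] that by simp
  qed
  \<comment> \<open>Both \<open>c r\<close> and \<open>c (1/2)\<close> are compared with the
    coefficients at radius \<open>r / 2\<close>, which is a dilation of either.\<close>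
  have c_eq: "c r \<alpha> = of_real r ^ multi_degree \<alpha> * (2 ^ multi_degree \<alpha> * c (1/2) \<alpha>)" if "0 < r" "r < 1" for r \<alpha>
  proof -
    have "of_real (1/2) ^ multi_degree \<alpha> * c r \<alpha> = of_real r ^ multi_degree \<alpha> * c (1/2) \<alpha>"
      using fun_cong[OF scale[of r "1/2"], of \<alpha>] fun_cong[OF scale[of "1/2" r], of \<alpha>] that
      by (simp add: mult.commute)
    then show ?thesis by (simp add: field_simps power_divide)
  qed
  show "has_power_series f (\<lambda>\<alpha>. 2 ^ multi_degree \<alpha> * c (1/2) \<alpha>)"
    unfolding has_power_series_def
  proof
    fix z :: "complex ^ 'n" assume "z \<in> polydisk"
    then obtain r where r: "0 < r" "r < 1" "\<And>i. norm (z $ i) < r"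
      by (rule polydisk_radius) blast
    define w where "w = (1 / r) *\<^sub>R z"
    have z: "z = r *\<^sub>R w" using r by (simp add: w_def)
    have "w \<in> polydisk" using r by (simp add: w_def polydisk_def divide_simps)
    from has_power_seriesD[OF c[OF r(1,2)] this]
    show "((\<lambda>\<alpha>. 2 ^ multi_degree \<alpha> * c (1/2) \<alpha> * vmonom \<alpha> z) has_sum f z) UNIV"
      unfolding z vmonom_scaleR c_eq[OF r(1,2)] by (simp only: mult_ac)
  qed
qed

lemma has_power_series_add:
  "has_power_series f a \<Longrightarrow> has_power_series g b \<Longrightarrow> has_power_series (\<lambda>z. f z + g z) (\<lambda>\<alpha>. a \<alpha> + b \<alpha>)"
  unfolding has_power_series_def by (auto simp: ring_distribs intro: has_sum_add)

lemma has_power_series_cmult: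
  "has_power_series f a \<Longrightarrow> has_power_series (\<lambda>z. c * f z) (\<lambda>\<alpha>. c * a \<alpha>)"
  unfolding has_power_series_def by (auto simp: mult.assoc intro: has_sum_cmult_right)

section \<open>The Hardy space in terms of power series coefficients\<close>

lemma borel_measurable_zero_off_polydisk:
  fixes f :: "complex ^ 'n::finite \<Rightarrow> complex"
  assumes "continuous_on polydisk f" "\<And>z. z \<notin> polydisk \<Longrightarrow> f z = 0"
  shows "f \<in> borel_measurable borel"
proof -
  have "(\<lambda>z. indicator polydisk z *\<^sub>R f z) \<in> borel_measurable borel"
    using assms(1) open_polydisk by (intro borel_measurable_continuous_on_indicator borel_open) auto
  also have "(\<lambda>z. indicator polydisk z *\<^sub>R f z) = f"
    using assms(2) by (auto simp: indicator_def)
  finally show ?thesis .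
qed

text \<open>Vanishing off the polydisk makes \<open>f\<close> and \<open>g\<close> Borel on the
  whole space, as the passage from \<open>torus_measure\<close> to the angles demands. Parseval then
  has explicit coefficients for both functions.\<close>

lemma mean_inner_has_sum:
  fixes f g :: "complex ^ 'n::finite \<Rightarrow> complex"
  assumes f: "has_power_series f a" "\<And>z. z \<notin> polydisk \<Longrightarrow> f z = 0"
    and g: "has_power_series g b" "\<And>z. z \<notin> polydisk \<Longrightarrow> g z = 0"
    and r: "0 \<le> r" "r < 1"
  shows "((\<lambda>\<beta>. of_real (r ^ (2 * multi_degree \<beta>)) * (a \<beta> * cnj (b \<beta>))) has_sum
    (LINT \<zeta>|torus_measure. f (r *\<^sub>R \<zeta>) * cnj (g (r *\<^sub>R \<zeta>)))) UNIV"
proof -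
  have m: "(\<lambda>\<zeta>. h (r *\<^sub>R \<zeta>)) \<in> borel_measurable borel"
    if "h \<in> borel_measurable borel" for h :: "complex ^ 'n \<Rightarrow> complex"
    by (rule measurable_compose[OF _ that]) (intro borel_measurable_continuous_onI continuous_intros)
  have "(LINT \<zeta>|torus_measure. f (r *\<^sub>R \<zeta>) * cnj (g (r *\<^sub>R \<zeta>))) =
      (LINT \<theta>|angles_measure. f (r *\<^sub>R torus_point \<theta>) * cnj (g (r *\<^sub>R torus_point \<theta>)))"
    using f g by (intro integral_torus_measure borel_measurable_times borel_measurable_cnj m
        borel_measurable_zero_off_polydisk has_power_series_continuous_on)
  moreover have "of_real r ^ m * cnj (b \<beta>) * (of_real r ^ m * a \<beta>) = of_real (r ^ (2 * m)) * (a \<beta> * cnj (b \<beta>))" for m \<beta>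
    by (simp add: mult_2 power_add)
  ultimately show ?thesis
    using Parseval[OF has_power_series_continuous_on[OF f(1)] g(1) r]
    unfolding power_series_coefficient[OF f(1) r] by (simp only:)
qed

lemma mean_square_has_sum:
  fixes f :: "complex ^ 'n::finite \<Rightarrow> complex"
  assumes f: "has_power_series f a" "\<And>z. z \<notin> polydisk \<Longrightarrow> f z = 0"
    and r: "0 \<le> r" "r < 1"
  shows "((\<lambda>\<beta>. r ^ (2 * multi_degree \<beta>) * (norm (a \<beta>))\<^sup>2) has_sum
    (LINT \<zeta>|torus_measure. (norm (f (r *\<^sub>R \<zeta>)))\<^sup>2)) UNIV"
proof -
  have "((\<lambda>\<beta>. complex_of_real (r ^ (2 * multi_degree \<beta>) * (norm (a \<beta>))\<^sup>2)) has_sum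
    complex_of_real (LINT \<zeta>|torus_measure. (norm (f (r *\<^sub>R \<zeta>)))\<^sup>2)) UNIV"
    using mean_inner_has_sum[OF f f r]
    unfolding of_real_mult complex_norm_square[symmetric] integral_complex_of_real[symmetric] by simp
  then show ?thesis by (simp only: has_sum_of_real_iff)
qed

text \<open>For finitely many terms the limit of the radius to 1 can be taken inside the sum, while
  each weighted partial sum stays below a mean bounded by \<open>M\<close>. This is the Fatou half
  of the norm identity; \<open>mean_square_le\<close> is the other half.\<close>

lemma H2_finite_sum_le:
  fixes f :: "complex ^ 'n::finite \<Rightarrow> complex"
  assumes f: "has_power_series f a" "\<And>z. z \<notin> polydisk \<Longrightarrow> f z = 0"
    and M: "\<And>r. 0 < r \<Longrightarrow> r < 1 \<Longrightarrow> (LINT \<zeta>|torus_measure. (norm (f (r *\<^sub>R \<zeta>)))\<^sup>2) \<le> M"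
    and X: "finite X"
  shows "(\<Sum>\<beta>\<in>X. (norm (a \<beta>))\<^sup>2) \<le> M"
proof (rule tendsto_upperbound)
  have "((\<lambda>r::real. \<Sum>\<beta>\<in>X. r ^ (2 * multi_degree \<beta>) * (norm (a \<beta>))\<^sup>2) \<longlongrightarrow>
      (\<Sum>\<beta>\<in>X. 1 ^ (2 * multi_degree \<beta>) * (norm (a \<beta>))\<^sup>2)) (at_left 1)"
    by (intro tendsto_intros)
  then show "((\<lambda>r::real. \<Sum>\<beta>\<in>X. r ^ (2 * multi_degree \<beta>) * (norm (a \<beta>))\<^sup>2) \<longlongrightarrow>
      (\<Sum>\<beta>\<in>X. (norm (a \<beta>))\<^sup>2)) (at_left 1)" by simp
  have "eventually (\<lambda>r::real. r \<in> {0<..<1}) (at_left 1)"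
    by (rule eventually_at_leftI[of 0]) auto
  then show "\<forall>\<^sub>F r in at_left (1::real). (\<Sum>\<beta>\<in>X. r ^ (2 * multi_degree \<beta>) * (norm (a \<beta>))\<^sup>2) \<le> M"
  proof eventually_elim
    case (elim r)
    have "(\<Sum>\<beta>\<in>X. r ^ (2 * multi_degree \<beta>) * (norm (a \<beta>))\<^sup>2) \<le> (LINT \<zeta>|torus_measure. (norm (f (r *\<^sub>R \<zeta>)))\<^sup>2)"
      using elim X by (intro finite_sum_le_has_sum[OF mean_square_has_sum[OF f]]) auto
    also have "\<dots> \<le> M" using elim by (intro M) auto
    finally show ?case .
  qed
qed simp

lemma mean_square_le:
  fixes f :: "complex ^ 'n::finite \<Rightarrow> complex"
  assumes f: "has_power_series f a" "\<And>z. z \<notin> polydisk \<Longrightarrow> f z = 0"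
    and a: "(\<lambda>\<beta>. (norm (a \<beta>))\<^sup>2) summable_on UNIV" and r: "0 < r" "r < 1"
  shows "(LINT \<zeta>|torus_measure. (norm (f (r *\<^sub>R \<zeta>)))\<^sup>2) \<le> (\<Sum>\<^sub>\<infinity>\<beta>. (norm (a \<beta>))\<^sup>2)"
proof (rule has_sum_mono[OF mean_square_has_sum[OF f] has_sum_infsum[OF a]])
  show "r ^ (2 * multi_degree \<beta>) * (norm (a \<beta>))\<^sup>2 \<le> (norm (a \<beta>))\<^sup>2" for \<beta>
    using r by (intro mult_left_le_one_le) (auto intro: power_le_one)
qed (use r in auto)

lemma H2_analytic: "f \<in> H2 \<Longrightarrow> analytic_vec_on f polydisk"
  and H2_zero: "f \<in> H2 \<Longrightarrow> z \<notin> polydisk \<Longrightarrow> f z = 0"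
  by (auto simp: H2_def)

definition power_coeff :: "(complex ^ 'n::finite \<Rightarrow> complex) \<Rightarrow> ('n \<Rightarrow> nat) \<Rightarrow> complex" where
  "power_coeff f = (THE a. has_power_series f a)"

lemma power_coeff_eq: "has_power_series f a \<Longrightarrow> power_coeff f = a"
  unfolding power_coeff_def by (blast intro: has_power_series_unique)

lemma H2_power_series:
  assumes "f \<in> H2"
  shows "has_power_series f (power_coeff f)"
  using analytic_has_power_series[OF H2_analytic[OF assms]] power_coeff_eq by metis

lemma H2_I:
  assumes "analytic_vec_on f polydisk" "\<And>z. z \<notin> polydisk \<Longrightarrow> f z = 0" "has_power_series f a"
    "(\<lambda>\<beta>. (norm (a \<beta>))\<^sup>2) summable_on UNIV"
  shows "f \<in> H2"
  unfolding H2_def using assms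
  by (auto simp: bdd_above_def intro!: exI[of _ "\<Sum>\<^sub>\<infinity>\<beta>. (norm (a \<beta>))\<^sup>2"] mean_square_le)

lemma H2_bounded_means:
  assumes "f \<in> H2" "0 < r" "r < 1"
  shows "(LINT \<zeta>|torus_measure. (norm (f (r *\<^sub>R \<zeta>)))\<^sup>2) \<le>
    (SUP r\<in>{0<..<1}. LINT \<zeta>|torus_measure. (norm (f (r *\<^sub>R \<zeta>)))\<^sup>2)"
  using assms by (intro cSUP_upper) (auto simp: H2_def)

lemma H2_square_summable:
  assumes "f \<in> H2"
  shows "(\<lambda>\<beta>. (norm (power_coeff f \<beta>))\<^sup>2) summable_on UNIV"
  by (rule nonneg_bounded_partial_sums_imp_summable_on, simp,
      rule eventually_finite_subsets_at_top_weakI,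
      rule H2_finite_sum_le[OF H2_power_series[OF assms] H2_zero[OF assms] H2_bounded_means[OF assms]]) auto

lemma H2_norm_has_sum:
  assumes f: "f \<in> H2"
  shows "((\<lambda>\<beta>. (norm (power_coeff f \<beta>))\<^sup>2) has_sum (H2_norm f)\<^sup>2) UNIV"
proof -
  let ?S = "SUP r\<in>{0<..<1}. LINT \<zeta>|torus_measure. (norm (f (r *\<^sub>R \<zeta>)))\<^sup>2"
  let ?I = "\<Sum>\<^sub>\<infinity>\<beta>. (norm (power_coeff f \<beta>))\<^sup>2"
  note ps = H2_power_series[OF f] H2_zero[OF f]
  have "?S \<le> ?I"
    by (rule cSUP_least) (auto intro!: mean_square_le[OF ps] H2_square_summable f)
  moreover have "?I \<le> ?S"
    by (rule infsum_le_finite_sums[OF H2_square_summable[OF f]])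
      (rule H2_finite_sum_le[OF ps H2_bounded_means[OF f]])
  ultimately have S: "?S = ?I" by simp
  have "0 \<le> ?I" by (rule infsum_nonneg) simp
  then have "(H2_norm f)\<^sup>2 = ?I" unfolding H2_norm_def S by simp
  then show ?thesis using has_sum_infsum[OF H2_square_summable[OF f]] by simp
qed

text \<open>The function \<open>sqrt\<close> is negative at negative arguments, so the supremum
  itself has to be shown nonnegative; the mean at radius 1/2 is a lower bound for it.\<close>

lemma H2_norm_nonneg:
  assumes f: "f \<in> H2"
  shows "0 \<le> H2_norm f"
proof -
  have "(LINT \<zeta>|torus_measure. (norm (f ((1/2) *\<^sub>R \<zeta>)))\<^sup>2) \<le>
    (SUP r\<in>{0<..<1}. LINT \<zeta>|torus_measure. (norm (f (r *\<^sub>R \<zeta>)))\<^sup>2)"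
    by (rule H2_bounded_means[OF f]) auto
  moreover have "0 \<le> (LINT \<zeta>|torus_measure. (norm (f ((1/2) *\<^sub>R \<zeta>)))\<^sup>2)"
    by (rule Bochner_Integration.integral_nonneg) simp
  ultimately show ?thesis unfolding H2_norm_def real_sqrt_ge_0_iff by (rule order_trans[rotated])
qed

lemma abs_summable_mult_cnj:
  fixes a b :: "'i \<Rightarrow> complex"
  assumes "(\<lambda>i. (norm (a i))\<^sup>2) summable_on I" "(\<lambda>i. (norm (b i))\<^sup>2) summable_on I"
  shows "(\<lambda>i. norm (a i * cnj (b i))) summable_on I"
proof (rule summable_on_comparison_test)
  show "(\<lambda>i. (norm (a i))\<^sup>2 + (norm (b i))\<^sup>2) summable_on I"
    using assms by (rule summable_on_add)
  show "norm (a i * cnj (b i)) \<le> (norm (a i))\<^sup>2 + (norm (b i))\<^sup>2" for i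
    using sum_squares_bound[of "norm (a i)" "norm (b i)"] zero_le_power2[of "norm (a i)"] zero_le_power2[of "norm (b i)"]
    unfolding norm_mult complex_mod_cnj by linarith
qed auto

text \<open>Shows at the same time that the limit defining \<open>H2_inner\<close> exists. The
  coefficient products are absolutely summable, so the weighted sums \<open>s r\<close> converge
  uniformly on the closed interval from 0 to 1. Hence \<open>s\<close> is continuous up to 1, and
  below 1 it coincides with the integral means.\<close>

lemma H2_inner_has_sum:
  assumes f: "f \<in> H2" and g: "g \<in> H2"
  shows "((\<lambda>\<beta>. power_coeff f \<beta> * cnj (power_coeff g \<beta>)) has_sum H2_inner f g) UNIV"
proof -
  define c where "c \<beta> = power_coeff f \<beta> * cnj (power_coeff g \<beta>)" for \<beta>
  have c: "(\<lambda>\<beta>. norm (c \<beta>)) summable_on UNIV"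
    unfolding c_def by (intro abs_summable_mult_cnj H2_square_summable f g)
  define s where "s r = (\<Sum>\<^sub>\<infinity>\<beta>. of_real (r ^ (2 * multi_degree \<beta>)) * c \<beta>)" for r :: real
  have "uniform_limit {0..1} (\<lambda>X r. \<Sum>\<beta>\<in>X. of_real (r ^ (2 * multi_degree \<beta>)) * c \<beta>) s (finite_subsets_at_top UNIV)"
    unfolding s_def
  proof (rule Weierstrass_m_test_general[OF _ c])
    show "norm (of_real (r ^ (2 * multi_degree \<beta>)) * c \<beta>) \<le> norm (c \<beta>)" if "r \<in> {0..1}" for \<beta> and r :: real
      using that by (auto simp: norm_mult norm_power intro!: mult_left_le_one_le power_le_one)
  qed
  then have "continuous_on {0..1} s"
    by (rule uniform_limit_theorem[rotated]) (auto intro!: always_eventually continuous_intros)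
  then have "(s \<longlongrightarrow> s 1) (at 1 within {0..1})"
    by (simp add: continuous_on_def)
  then have lim: "(s \<longlongrightarrow> s 1) (at_left 1)"
    by (simp add: at_within_Icc_at_left)
  have ev: "eventually (\<lambda>r::real. r \<in> {0<..<1}) (at_left 1)"
    by (rule eventually_at_leftI[of 0]) auto
  have "((\<lambda>r. LINT \<zeta>|torus_measure. f (r *\<^sub>R \<zeta>) * cnj (g (r *\<^sub>R \<zeta>))) \<longlongrightarrow> s 1) (at_left 1)"
  proof (rule Lim_transform_eventually[OF lim])
    show "\<forall>\<^sub>F r in at_left 1. s r = (LINT \<zeta>|torus_measure. f (r *\<^sub>R \<zeta>) * cnj (g (r *\<^sub>R \<zeta>)))"
      using ev
    proof eventually_elim
      case (elim r)
      show ?case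
        unfolding s_def c_def using elim
        by (intro infsumI mean_inner_has_sum H2_power_series H2_zero f g) auto
    qed
  qed
  then have "H2_inner f g = s 1"
    unfolding H2_inner_def by (intro tendsto_Lim) auto
  also have "s 1 = infsum c UNIV" by (simp add: s_def)
  finally show ?thesis
    using has_sum_infsum[OF abs_summable_summable[OF c]] by (simp add: c_def[abs_def])
qed

lemma H2_inner_cnj:
  assumes f: "f \<in> H2" and g: "g \<in> H2"
  shows "H2_inner g f = cnj (H2_inner f g)"
proof -
  have "((\<lambda>\<beta>. cnj (power_coeff f \<beta> * cnj (power_coeff g \<beta>))) has_sum cnj (H2_inner f g)) UNIV"
    using H2_inner_has_sum[OF f g] by (simp only: has_sum_cnj_iff)
  then have "((\<lambda>\<beta>. power_coeff g \<beta> * cnj (power_coeff f \<beta>)) has_sum cnj (H2_inner f g)) UNIV"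
    by (simp add: mult.commute)
  then show ?thesis using H2_inner_has_sum[OF g f] has_sum_unique by blast
qed

lemma H2_Cauchy_Schwarz:
  assumes f: "f \<in> H2" and g: "g \<in> H2"
  shows "norm (H2_inner f g) \<le> H2_norm f * H2_norm g"
proof (rule tendsto_upperbound)
  show "((\<lambda>X. norm (\<Sum>\<beta>\<in>X. power_coeff f \<beta> * cnj (power_coeff g \<beta>))) \<longlongrightarrow> norm (H2_inner f g)) (finite_subsets_at_top UNIV)"
    using H2_inner_has_sum[OF f g] unfolding has_sum_def by (rule tendsto_norm)
  show "\<forall>\<^sub>F X in finite_subsets_at_top UNIV. norm (\<Sum>\<beta>\<in>X. power_coeff f \<beta> * cnj (power_coeff g \<beta>)) \<le> H2_norm f * H2_norm g"
  proof (rule eventually_finite_subsets_at_top_weakI)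
    fix X :: "('a \<Rightarrow> nat) set" assume X: "finite X"
    have L2: "L2_set (\<lambda>\<beta>. norm (power_coeff h \<beta>)) X \<le> H2_norm h" if "h \<in> H2" for h :: "complex ^ 'a \<Rightarrow> complex"
      unfolding L2_set_def
      by (rule real_le_lsqrt[OF H2_norm_nonneg[OF that]])
        (rule finite_sum_le_has_sum[OF H2_norm_has_sum[OF that]], use X in auto)
    have "norm (\<Sum>\<beta>\<in>X. power_coeff f \<beta> * cnj (power_coeff g \<beta>)) \<le> (\<Sum>\<beta>\<in>X. \<bar>norm (power_coeff f \<beta>)\<bar> * \<bar>norm (power_coeff g \<beta>)\<bar>)"
      by (rule order_trans[OF norm_sum]) (simp add: norm_mult)
    also have "\<dots> \<le> L2_set (\<lambda>\<beta>. norm (power_coeff f \<beta>)) X * L2_set (\<lambda>\<beta>. norm (power_coeff g \<beta>)) X"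
      by (rule L2_set_mult_ineq)
    also have "\<dots> \<le> H2_norm f * H2_norm g"
      by (intro mult_mono L2 f g H2_norm_nonneg L2_set_nonneg)
    finally show "norm (\<Sum>\<beta>\<in>X. power_coeff f \<beta> * cnj (power_coeff g \<beta>)) \<le> H2_norm f * H2_norm g" .
  qed
qed simp

section \<open>Linear structure and density of polynomials\<close>

lemma H2_add:
  assumes f: "f \<in> H2" and g: "g \<in> H2"
  shows "(\<lambda>z. f z + g z) \<in> H2"
proof (rule H2_I)
  show "has_power_series (\<lambda>z. f z + g z) (\<lambda>\<alpha>. power_coeff f \<alpha> + power_coeff g \<alpha>)"
    by (intro has_power_series_add H2_power_series f g)
  show "(\<lambda>\<beta>. (norm (power_coeff f \<beta> + power_coeff g \<beta>))\<^sup>2) summable_on UNIV"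
  proof (rule summable_on_comparison_test)
    show "(\<lambda>\<beta>. 2 * (norm (power_coeff f \<beta>))\<^sup>2 + 2 * (norm (power_coeff g \<beta>))\<^sup>2) summable_on UNIV"
      by (intro summable_on_add summable_on_cmult_right H2_square_summable f g)
    fix \<beta>
    let ?x = "norm (power_coeff f \<beta>)" and ?y = "norm (power_coeff g \<beta>)"
    have "(norm (power_coeff f \<beta> + power_coeff g \<beta>))\<^sup>2 \<le> (?x + ?y)\<^sup>2"
      by (intro power_mono norm_triangle_ineq) auto
    also have "\<dots> \<le> 2 * ?x\<^sup>2 + 2 * ?y\<^sup>2"
      using sum_squares_bound[of ?x ?y] by (simp add: power2_sum)
    finally show "(norm (power_coeff f \<beta> + power_coeff g \<beta>))\<^sup>2 \<le> 2 * ?x\<^sup>2 + 2 * ?y\<^sup>2" .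
  qed auto
qed (use f g in \<open>auto intro: analytic_vec_on_add H2_analytic simp: H2_zero\<close>)

lemma H2_cmult:
  assumes f: "f \<in> H2"
  shows "(\<lambda>z. c * f z) \<in> H2"
proof (rule H2_I)
  show "has_power_series (\<lambda>z. c * f z) (\<lambda>\<alpha>. c * power_coeff f \<alpha>)"
    by (intro has_power_series_cmult H2_power_series f)
  show "(\<lambda>\<beta>. (norm (c * power_coeff f \<beta>))\<^sup>2) summable_on UNIV"
    unfolding norm_mult power_mult_distrib by (intro summable_on_cmult_right H2_square_summable f)
qed (use f in \<open>auto intro: analytic_vec_on_mult analytic_vec_on_const H2_analytic simp: H2_zero\<close>)

lemma H2_inner_add_right:
  assumes "f \<in> H2" "g \<in> H2" "h \<in> H2"
  shows "H2_inner f (\<lambda>z. g z + h z) = H2_inner f g + H2_inner f h"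
proof -
  have "power_coeff (\<lambda>z. g z + h z) = (\<lambda>\<beta>. power_coeff g \<beta> + power_coeff h \<beta>)"
    by (intro power_coeff_eq has_power_series_add H2_power_series assms)
  then show ?thesis
    using H2_inner_has_sum[OF assms(1) H2_add[OF assms(2,3)]]
      has_sum_add[OF H2_inner_has_sum[OF assms(1,2)] H2_inner_has_sum[OF assms(1,3)]]
    by (simp add: ring_distribs has_sum_unique)
qed

lemma H2_inner_cmult_right:
  assumes "f \<in> H2" "g \<in> H2"
  shows "H2_inner f (\<lambda>z. c * g z) = cnj c * H2_inner f g"
proof -
  have "power_coeff (\<lambda>z. c * g z) = (\<lambda>\<beta>. c * power_coeff g \<beta>)"
    by (intro power_coeff_eq has_power_series_cmult H2_power_series assms)
  then have "((\<lambda>\<beta>. cnj c * (power_coeff f \<beta> * cnj (power_coeff g \<beta>))) has_sum H2_inner f (\<lambda>z. c * g z)) UNIV"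
    using H2_inner_has_sum[OF assms(1) H2_cmult[OF assms(2), of c]] by (simp add: mult.left_commute)
  then show ?thesis
    using has_sum_cmult_right[OF H2_inner_has_sum[OF assms(1,2)], of "cnj c"] by (rule has_sum_unique)
qed

lemma H2_zero_fun: "(\<lambda>z. 0) \<in> H2"
  by (rule H2_I[of _ "\<lambda>_. 0"]) (auto simp: analytic_vec_on_const has_power_series_def)

lemma H2_sum: "(\<And>i. i \<in> I \<Longrightarrow> g i \<in> H2) \<Longrightarrow> (\<lambda>z. \<Sum>i\<in>I. g i z) \<in> H2"
  by (induction I rule: infinite_finite_induct) (auto simp: H2_zero_fun intro!: H2_add)

lemma H2_inner_sum_right:
  assumes "f \<in> H2" "\<And>i. i \<in> I \<Longrightarrow> g i \<in> H2"
  shows "H2_inner f (\<lambda>z. \<Sum>i\<in>I. g i z) = (\<Sum>i\<in>I. H2_inner f (g i))"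
proof -
  have zero: "H2_inner f (\<lambda>z. 0) = 0"
    using H2_inner_cmult_right[OF assms(1) H2_zero_fun, of 0] by simp
  show ?thesis
    using assms(2)
    by (induction I rule: infinite_finite_induct)
      (auto simp: zero H2_inner_add_right[OF assms(1)] H2_sum)
qed

definition H2_monom :: "('n::finite \<Rightarrow> nat) \<Rightarrow> complex ^ 'n \<Rightarrow> complex" where
  "H2_monom \<alpha> z = (if z \<in> polydisk then vmonom \<alpha> z else 0)"

lemma H2_monom_power_series: "has_power_series (H2_monom \<alpha>) (\<lambda>\<beta>. if \<beta> = \<alpha> then 1 else 0)"
  by (rule has_power_series_cong[OF has_power_series_vmonom]) (simp add: H2_monom_def)

lemma H2_monom_in_H2: "H2_monom \<alpha> \<in> H2"
proof (rule H2_I[OF _ _ H2_monom_power_series])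
  show "analytic_vec_on (H2_monom \<alpha>) polydisk"
    by (rule analytic_vec_on_cong[OF open_polydisk _ analytic_vec_on_vmonom]) (simp add: H2_monom_def)
  show "(\<lambda>\<beta>. (norm (if \<beta> = \<alpha> then 1 else 0 :: complex))\<^sup>2) summable_on UNIV"
    by (rule has_sum_imp_summable[OF has_sum_finite_neutralI[of "{\<alpha>}"]]) auto
qed (simp add: H2_monom_def)

text \<open>The squared norm of the tail is the full square sum minus a partial sum. The difference
  is written with \<open>+ - 1 *\<close> so that the rules for sums and scalar multiples apply to it
  literally.\<close>

lemma H2_truncation_tendsto:
  fixes g :: "complex ^ 'n::finite \<Rightarrow> complex"
  assumes g: "g \<in> H2"
  shows "((\<lambda>X. H2_norm (\<lambda>z. g z + - 1 * (\<Sum>\<alpha>\<in>X. power_coeff g \<alpha> * H2_monom \<alpha> z))) \<longlongrightarrow> 0) (finite_subsets_at_top UNIV)"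
proof -
  define h where "h X = (\<lambda>z. g z + - 1 * (\<Sum>\<alpha>\<in>X. power_coeff g \<alpha> * H2_monom \<alpha> z))" for X
  have h: "h X \<in> H2" for X
    unfolding h_def by (intro H2_add H2_cmult H2_sum H2_monom_in_H2 g)
  have coeff: "power_coeff (h X) \<beta> = (if \<beta> \<in> X then 0 else power_coeff g \<beta>)" if X: "finite X" for X \<beta>
  proof -
    have "has_power_series (\<lambda>z. \<Sum>\<alpha>\<in>X. power_coeff g \<alpha> * H2_monom \<alpha> z) (\<lambda>\<alpha>. if \<alpha> \<in> X then power_coeff g \<alpha> else 0)"
      by (rule has_power_series_cong[OF has_power_series_sum_vmonom[OF X]]) (simp add: H2_monom_def)
    then have "has_power_series (h X) (\<lambda>\<alpha>. power_coeff g \<alpha> + - 1 * (if \<alpha> \<in> X then power_coeff g \<alpha> else 0))"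
      unfolding h_def by (intro has_power_series_add has_power_series_cmult H2_power_series g)
    then show ?thesis by (simp add: power_coeff_eq)
  qed
  have norm_sq: "(H2_norm (h X))\<^sup>2 = (H2_norm g)\<^sup>2 - (\<Sum>\<beta>\<in>X. (norm (power_coeff g \<beta>))\<^sup>2)" if X: "finite X" for X
  proof -
    have "((\<lambda>\<beta>. (norm (power_coeff g \<beta>))\<^sup>2 + - (if \<beta> \<in> X then (norm (power_coeff g \<beta>))\<^sup>2 else 0)) has_sum
       ((H2_norm g)\<^sup>2 + - (\<Sum>\<beta>\<in>X. (norm (power_coeff g \<beta>))\<^sup>2))) UNIV"
    proof (intro has_sum_add has_sum_uminusI H2_norm_has_sum g)
      have "((\<lambda>\<beta>. (norm (power_coeff g \<beta>))\<^sup>2) has_sum (\<Sum>\<beta>\<in>X. (norm (power_coeff g \<beta>))\<^sup>2)) X"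
        using X by (rule has_sum_finite)
      then show "((\<lambda>\<beta>. if \<beta> \<in> X then (norm (power_coeff g \<beta>))\<^sup>2 else 0) has_sum (\<Sum>\<beta>\<in>X. (norm (power_coeff g \<beta>))\<^sup>2)) UNIV"
        by (rule has_sum_cong_neutral[THEN iffD1, rotated 3]) auto
    qed
    moreover have "(\<lambda>\<beta>. (norm (power_coeff g \<beta>))\<^sup>2 + - (if \<beta> \<in> X then (norm (power_coeff g \<beta>))\<^sup>2 else 0)) =
       (\<lambda>\<beta>. (norm (power_coeff (h X) \<beta>))\<^sup>2)"
      by (simp add: coeff[OF X] fun_eq_iff)
    ultimately show ?thesis using has_sum_unique[OF H2_norm_has_sum[OF h[of X]]] by simp
  qed
  have "((\<lambda>X. sqrt ((H2_norm g)\<^sup>2 - (\<Sum>\<beta>\<in>X. (norm (power_coeff g \<beta>))\<^sup>2))) \<longlongrightarrow> sqrt ((H2_norm g)\<^sup>2 - (H2_norm g)\<^sup>2))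
      (finite_subsets_at_top UNIV)"
    using H2_norm_has_sum[OF g] unfolding has_sum_def by (intro tendsto_intros)
  then have "((\<lambda>X. sqrt ((H2_norm g)\<^sup>2 - (\<Sum>\<beta>\<in>X. (norm (power_coeff g \<beta>))\<^sup>2))) \<longlongrightarrow> 0) (finite_subsets_at_top UNIV)"
    by simp
  moreover have "\<forall>\<^sub>F X in finite_subsets_at_top UNIV. sqrt ((H2_norm g)\<^sup>2 - (\<Sum>\<beta>\<in>X. (norm (power_coeff g \<beta>))\<^sup>2)) = H2_norm (h X)"
    by (rule eventually_finite_subsets_at_top_weakI) (simp add: norm_sq[symmetric] H2_norm_nonneg[OF h])
  ultimately show ?thesis
    unfolding h_def[symmetric] by (rule Lim_transform_eventually)
qed

section \<open>Partial derivatives of power series\<close>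

lemma vmonom_split: "vmonom \<alpha> z = z $ i ^ \<alpha> i * (\<Prod>j\<in>UNIV - {i}. z $ j ^ \<alpha> j)"
  unfolding vmonom_def by (rule prod.remove) auto

text \<open>With the other coordinates frozen, the partial sums are polynomials in one variable that
  converge uniformly on a disk around 0, and such a limit may be differentiated termwise. The series
  is all that is used of \<open>f\<close>, so the result can be iterated.\<close>

lemma has_power_series_partial_deriv:
  fixes f :: "complex ^ 'n::finite \<Rightarrow> complex"
  assumes f: "has_power_series f a"
  shows "has_power_series (partial_deriv i f) (\<lambda>\<alpha>. of_nat (Suc (\<alpha> i)) * a (\<alpha>(i := Suc (\<alpha> i))))"
  unfolding has_power_series_def
proof
  fix z :: "complex ^ 'n" assume z: "z \<in> polydisk"
  obtain r where r: "0 < r" "r < 1" "\<And>j. norm (z $ j) < r"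
    using z by (rule polydisk_radius) blast
  define p where "p w = (\<chi> j. if j = i then w else z $ j)" for w
  define c where "c \<alpha> = a \<alpha> * (\<Prod>j\<in>UNIV - {i}. z $ j ^ \<alpha> j)" for \<alpha>
  have p: "vmonom \<alpha> (p w) = w ^ \<alpha> i * (\<Prod>j\<in>UNIV - {i}. z $ j ^ \<alpha> j)" for \<alpha> w
    unfolding vmonom_split[of _ _ i] by (simp add: p_def)
  have ul: "uniform_limit (cball 0 r) (\<lambda>X w. \<Sum>\<alpha>\<in>X. c \<alpha> * w ^ \<alpha> i) (\<lambda>w. f (p w)) (finite_subsets_at_top UNIV)"
  proof (rule uniform_limitI)
    fix e :: real assume "0 < e"
    then have "\<forall>\<^sub>F X in finite_subsets_at_top UNIV. \<forall>z\<in>{z. \<forall>i. norm (z $ i) \<le> r}.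
        dist (\<Sum>\<alpha>\<in>X. a \<alpha> * vmonom \<alpha> z) (f z) < e"
      using r by (intro uniform_limitD has_power_series_uniform_limit f) auto
    then show "\<forall>\<^sub>F X in finite_subsets_at_top UNIV. \<forall>w\<in>cball 0 r. dist (\<Sum>\<alpha>\<in>X. c \<alpha> * w ^ \<alpha> i) (f (p w)) < e"
    proof eventually_elim
      case (elim X)
      show ?case
      proof
        fix w :: complex assume "w \<in> cball 0 r"
        then have "p w \<in> {z. \<forall>i. norm (z $ i) \<le> r}"
          using r by (auto simp: p_def intro: less_imp_le)
        from bspec[OF elim this] show "dist (\<Sum>\<alpha>\<in>X. c \<alpha> * w ^ \<alpha> i) (f (p w)) < e"
          by (simp add: p c_def mult_ac)
      qed
    qed
  qed
  have ev: "\<forall>\<^sub>F X in finite_subsets_at_top UNIV. continuous_on (cball 0 r) (\<lambda>w. \<Sum>\<alpha>\<in>X. c \<alpha> * w ^ \<alpha> i) \<and>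
    (\<forall>w\<in>ball 0 r. ((\<lambda>w. \<Sum>\<alpha>\<in>X. c \<alpha> * w ^ \<alpha> i) has_field_derivative (\<Sum>\<alpha>\<in>X. c \<alpha> * (of_nat (\<alpha> i) * w ^ (\<alpha> i - 1)))) (at w))"
    by (intro always_eventually allI conjI ballI)
      (auto intro!: continuous_intros derivative_eq_intros sum.cong)
  obtain g' where g': "\<And>w. w \<in> ball 0 r \<Longrightarrow> ((\<lambda>w. f (p w)) has_field_derivative g' w) (at w) \<and>
      ((\<lambda>X. \<Sum>\<alpha>\<in>X. c \<alpha> * (of_nat (\<alpha> i) * w ^ (\<alpha> i - 1))) \<longlongrightarrow> g' w) (finite_subsets_at_top UNIV)"
    using has_complex_derivative_uniform_limit[OF ev ul _ r(1)] by auto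
  have zi: "z $ i \<in> ball 0 r" using r(3) by simp
  have "partial_deriv i f z = g' (z $ i)"
    unfolding partial_deriv_def p_def[symmetric] using g'[OF zi] by (auto intro: DERIV_imp_deriv)
  then have "((\<lambda>\<alpha>. c \<alpha> * (of_nat (\<alpha> i) * (z $ i) ^ (\<alpha> i - 1))) has_sum partial_deriv i f z) UNIV"
    unfolding has_sum_def using g'[OF zi] by simp
  \<comment> \<open>The terms with \<open>\<alpha> i = 0\<close> carry the factor 0. Without them,
    lowering the \<open>i\<close>-th exponent by one is a bijection onto all multi-indices.\<close>
  then have "((\<lambda>\<alpha>. c \<alpha> * (of_nat (\<alpha> i) * (z $ i) ^ (\<alpha> i - 1))) has_sum partial_deriv i f z) {\<alpha>. 0 < \<alpha> i}"
    by (rule has_sum_cong_neutral[THEN iffD1, rotated 3]) auto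
  then have "((\<lambda>\<alpha>. c (\<alpha>(i := Suc (\<alpha> i))) * (of_nat (Suc (\<alpha> i)) * (z $ i) ^ \<alpha> i)) has_sum partial_deriv i f z) UNIV"
    by (rule has_sum_reindex_bij_witness[where i = "\<lambda>\<alpha>. \<alpha>(i := Suc (\<alpha> i))" and j = "\<lambda>\<alpha>. \<alpha>(i := \<alpha> i - 1)", THEN iffD1, rotated -1])
      auto
  moreover have "c (\<alpha>(i := Suc (\<alpha> i))) = a (\<alpha>(i := Suc (\<alpha> i))) * (\<Prod>j\<in>UNIV - {i}. z $ j ^ \<alpha> j)" for \<alpha>
    unfolding c_def by (auto intro!: prod.cong)
  ultimately show "((\<lambda>\<alpha>. of_nat (Suc (\<alpha> i)) * a (\<alpha>(i := Suc (\<alpha> i))) * vmonom \<alpha> z) has_sum partial_deriv i f z) UNIV"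
    unfolding vmonom_split[of _ _ i] by (simp only: mult_ac)
qed

lemma has_power_series_partial_deriv_funpow:
  fixes f :: "complex ^ 'n::finite \<Rightarrow> complex"
  assumes f: "has_power_series f a"
  shows "has_power_series ((partial_deriv i ^^ m) f) (\<lambda>\<alpha>. fact (\<alpha> i + m) / fact (\<alpha> i) * a (\<alpha>(i := \<alpha> i + m)))"
proof (induction m)
  case 0
  then show ?case using f by simp
next
  case (Suc m)
  have "of_nat (Suc n) * (fact (Suc n + m) / fact (Suc n)) = (fact (n + Suc m) / fact n :: complex)" for n
    by (simp add: field_simps del: of_nat_Suc)
  then have "of_nat (Suc (\<alpha> i)) * (fact ((\<alpha>(i := Suc (\<alpha> i))) i + m) / fact ((\<alpha>(i := Suc (\<alpha> i))) i) *
        a ((\<alpha>(i := Suc (\<alpha> i)))(i := (\<alpha>(i := Suc (\<alpha> i))) i + m))) =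
      fact (\<alpha> i + Suc m) / fact (\<alpha> i) * a (\<alpha>(i := \<alpha> i + Suc m))" for \<alpha> :: "'n \<Rightarrow> nat"
    unfolding mult.assoc[symmetric] fun_upd_same fun_upd_upd by simp
  then show ?case
    using has_power_series_partial_deriv[OF Suc, of i] by (simp only: funpow.simps o_apply)
qed

text \<open>An arbitrary distinct list is allowed so that the induction can pass to its tail.
  Distinctness ensures that each exponent is shifted once; the resulting coefficients depend on
  \<open>set xs\<close> alone, so the order of differentiation does not affect them.\<close>

lemma has_power_series_foldr_partial_deriv:
  fixes f :: "complex ^ 'n::finite \<Rightarrow> complex"
  assumes f: "has_power_series f a" and "distinct xs"
  shows "has_power_series (foldr (\<lambda>i. partial_deriv i ^^ k i) xs f)
    (\<lambda>\<alpha>. (\<Prod>i\<in>set xs. fact (\<alpha> i + k i) / fact (\<alpha> i)) * a (\<lambda>i. if i \<in> set xs then \<alpha> i + k i else \<alpha> i))"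
  using assms(2)
proof (induction xs)
  case Nil
  then show ?case using f by simp
next
  case (Cons x xs)
  have ih: "has_power_series (foldr (\<lambda>i. partial_deriv i ^^ k i) xs f)
    (\<lambda>\<alpha>. (\<Prod>i\<in>set xs. fact (\<alpha> i + k i) / fact (\<alpha> i)) * a (\<lambda>i. if i \<in> set xs then \<alpha> i + k i else \<alpha> i))"
    using Cons by simp
  have "fact (\<alpha> x + k x) / fact (\<alpha> x) *
      ((\<Prod>i\<in>set xs. fact ((\<alpha>(x := \<alpha> x + k x)) i + k i) / fact ((\<alpha>(x := \<alpha> x + k x)) i)) *
        a (\<lambda>i. if i \<in> set xs then (\<alpha>(x := \<alpha> x + k x)) i + k i else (\<alpha>(x := \<alpha> x + k x)) i)) =
      (\<Prod>i\<in>set (x # xs). fact (\<alpha> i + k i) / fact (\<alpha> i)) * a (\<lambda>i. if i \<in> set (x # xs) then \<alpha> i + k i else \<alpha> i)" for \<alpha> :: "'n \<Rightarrow> nat"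
  proof -
    have x: "x \<notin> set xs" using Cons.prems by simp
    have "(\<Prod>i\<in>set xs. fact ((\<alpha>(x := \<alpha> x + k x)) i + k i) / fact ((\<alpha>(x := \<alpha> x + k x)) i)) =
      (\<Prod>i\<in>set xs. fact (\<alpha> i + k i) / fact (\<alpha> i) :: complex)"
      using x by (intro prod.cong) auto
    moreover have "(\<lambda>i. if i \<in> set xs then (\<alpha>(x := \<alpha> x + k x)) i + k i else (\<alpha>(x := \<alpha> x + k x)) i) =
        (\<lambda>i. if i \<in> set (x # xs) then \<alpha> i + k i else \<alpha> i)"
      using x by (auto simp: fun_eq_iff)
    ultimately show ?thesis using x by simp
  qed
  then show ?case
    using has_power_series_partial_deriv_funpow[OF ih, where i = x and m = "k x"] by simp
qed

lemma has_power_series_mixed_partial: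
  fixes f :: "(complex, 'n::{finite,linorder}) vec \<Rightarrow> complex"
  assumes "has_power_series f a"
  shows "has_power_series (mixed_partial k f) (\<lambda>\<alpha>. (\<Prod>i\<in>UNIV. fact (\<alpha> i + k i) / fact (\<alpha> i)) * a (\<lambda>i. \<alpha> i + k i))"
  unfolding mixed_partial_def
  using has_power_series_foldr_partial_deriv[OF assms, of "sorted_list_of_set UNIV" k] by simp

section \<open>Reproducing kernels for mixed partial derivatives\<close>

text \<open>The hockey-stick identity, read as convolution with the geometric series. The general
  type serves two uses: complex terms for the value of the series and real norms for its absolute
  convergence.\<close>

lemma binomial_Cauchy_product:
  fixes y :: "'a::comm_semiring_1"
  shows "(\<Sum>i\<le>n. of_nat ((i + k) choose k) * y ^ i * y ^ (n - i)) = of_nat ((n + Suc k) choose Suc k) * y ^ n"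
proof -
  have choose: "(\<Sum>i\<le>n. (i + k) choose k) = (n + Suc k) choose Suc k"
    by (induction n) simp_all
  have "(\<Sum>i\<le>n. of_nat ((i + k) choose k) * y ^ i * y ^ (n - i)) = (\<Sum>i\<le>n. of_nat ((i + k) choose k) * y ^ n)"
    by (intro sum.cong refl) (simp add: mult.assoc flip: power_add)
  then show ?thesis by (simp only: choose[symmetric] of_nat_sum sum_distrib_right)
qed

text \<open>Induction on \<open>k\<close>: each further factor \<open>1 / (1 - x)\<close> is a
  Cauchy product with the geometric series. Convergence of the ordered series is not yet
  \<open>has_sum\<close>, so the same convolution is repeated with norms.\<close>

lemma binomial_series_has_sum:
  assumes "norm (x :: complex) < 1"
  shows "((\<lambda>n. of_nat ((n + k) choose k) * x ^ n) has_sum 1 / (1 - x) ^ (k + 1)) UNIV"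
proof (induction k)
  case 0
  then show ?case using geometric_has_sum[OF assms] by simp
next
  case (Suc k)
  let ?a = "\<lambda>n. of_nat ((n + k) choose k) * x ^ n" and ?b = "\<lambda>n. x ^ n"
  have na: "summable (\<lambda>n. norm (?a n))"
    by (intro summable_on_imp_summable has_sum_imp_summable[OF Suc, unfolded summable_on_iff_abs_summable_on_complex])
  have nb: "summable (\<lambda>n. norm (?b n))"
    using assms by (simp add: norm_power)
  have "(\<lambda>n. \<Sum>i\<le>n. ?a i * ?b (n - i)) sums ((\<Sum>n. ?a n) * (\<Sum>n. ?b n))"
    using na nb by (rule Cauchy_product_sums)
  also have "(\<Sum>n. ?a n) * (\<Sum>n. ?b n) = 1 / (1 - x) ^ (k + 1) * (1 / (1 - x))"
    using sums_unique[OF has_sum_imp_sums[OF Suc]] sums_unique[OF geometric_sums[OF assms]] by simp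
  also have "\<dots> = 1 / (1 - x) ^ (Suc k + 1)"
    by simp
  finally have s: "(\<lambda>n. of_nat ((n + Suc k) choose Suc k) * x ^ n) sums (1 / (1 - x) ^ (Suc k + 1))"
    by (simp only: binomial_Cauchy_product)
  have "summable (\<lambda>n. \<Sum>i\<le>n. norm (?a i) * norm (?b (n - i)))"
    using na nb by (intro summable_Cauchy_product) auto
  then have "summable (\<lambda>n. norm (of_nat ((n + Suc k) choose Suc k) * x ^ n))"
    by (simp only: norm_mult norm_power norm_of_nat binomial_Cauchy_product)
  then show ?case using s by (rule norm_summable_imp_has_sum)
qed

section \<open>Kernels and their coefficients\<close>

text \<open>The \<open>k\<close>-th derivative of \<open>x ^ m\<close> at \<open>c\<close>. Its
  generating function in \<open>z\<close> is therefore the \<open>k\<close>-th derivative of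
  \<open>1 / (1 - c * z)\<close> with respect to \<open>c\<close>.\<close>

definition kernel_coeff :: "nat \<Rightarrow> complex \<Rightarrow> nat \<Rightarrow> complex" where
  "kernel_coeff k c m = (if k \<le> m then fact m / fact (m - k) * c ^ (m - k) else 0)"

lemma kernel_coeff_has_sum:
  assumes "norm (c * z) < 1"
  shows "((\<lambda>m. kernel_coeff k c m * z ^ m) has_sum fact k * z ^ k / (1 - c * z) ^ (k + 1)) UNIV"
proof -
  have "((\<lambda>n. fact k * z ^ k * (of_nat ((n + k) choose k) * (c * z) ^ n)) has_sum
      fact k * z ^ k * (1 / (1 - c * z) ^ (k + 1))) UNIV"
    by (intro has_sum_cmult_right binomial_series_has_sum assms)
  also have "(\<lambda>n. fact k * z ^ k * (of_nat ((n + k) choose k) * (c * z) ^ n)) = (\<lambda>n. kernel_coeff k c (n + k) * z ^ (n + k))"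
  proof
    fix n
    have "of_nat ((n + k) choose k) = (fact (n + k) / (fact k * fact n) :: complex)"
      using binomial_fact[of k "n + k"] by simp
    then show "fact k * z ^ k * (of_nat ((n + k) choose k) * (c * z) ^ n) = kernel_coeff k c (n + k) * z ^ (n + k)"
      by (simp add: kernel_coeff_def power_add power_mult_distrib field_simps)
  qed
  finally have "((\<lambda>m. kernel_coeff k c m * z ^ m) has_sum fact k * z ^ k * (1 / (1 - c * z) ^ (k + 1))) {k..}"
    by (rule has_sum_reindex_bij_witness[where i = "\<lambda>m. m - k" and j = "\<lambda>n. n + k", THEN iffD1, rotated -1]) auto
  then have "((\<lambda>m. kernel_coeff k c m * z ^ m) has_sum fact k * z ^ k * (1 / (1 - c * z) ^ (k + 1))) UNIV"
    by (rule has_sum_cong_neutral[THEN iffD1, rotated 3]) (auto simp: kernel_coeff_def)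
  then show ?thesis by simp
qed

lemma kernel_coeff_norm_summable_on:
  assumes "norm (c * z) < 1"
  shows "(\<lambda>m. norm (kernel_coeff k c m * z ^ m)) summable_on UNIV"
  using has_sum_imp_summable[OF kernel_coeff_has_sum[OF assms]]
  by (simp only: summable_on_iff_abs_summable_on_complex)

text \<open>The Szego kernel of the polydisk, the product of the factors
  \<open>1 / (1 - cnj (w $ i) * z $ i)\<close>, differentiated \<open>k i\<close> times in the
  variable \<open>cnj (w $ i)\<close> for each \<open>i\<close>. For \<open>k = 0\<close> it is the
  reproducing kernel itself.\<close>

definition H2_kernel :: "('n::finite \<Rightarrow> nat) \<Rightarrow> complex ^ 'n \<Rightarrow> complex ^ 'n \<Rightarrow> complex" where
  "H2_kernel k w z = (if z \<in> polydisk
     then \<Prod>i\<in>UNIV. fact (k i) * (z $ i) ^ k i / (1 - cnj (w $ i) * z $ i) ^ (k i + 1) else 0)"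

lemma norm_cnj_mult_less_1:
  assumes "norm c < 1" "norm z < 1"
  shows "norm (cnj c * z) < 1"
  using mult_strict_mono[of "norm c" 1 "norm z" 1] assms by (simp add: norm_mult)

lemma one_minus_cnj_mult_nonzero:
  assumes "norm c < 1" "norm z < 1"
  shows "1 - cnj c * z \<noteq> 0"
  using norm_cnj_mult_less_1[OF assms] by auto

lemma H2_kernel_power_series:
  assumes w: "w \<in> polydisk"
  shows "has_power_series (H2_kernel k w) (\<lambda>\<alpha>. \<Prod>i\<in>UNIV. kernel_coeff (k i) (cnj (w $ i)) (\<alpha> i))"
  unfolding has_power_series_def
proof
  fix z :: "complex ^ 'a" assume z: "z \<in> polydisk"
  have "norm (cnj (w $ i) * z $ i) < 1" for i
    by (intro norm_cnj_mult_less_1 polydiskD w z)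
  then have "((\<lambda>\<alpha>. \<Prod>i\<in>UNIV. kernel_coeff (k i) (cnj (w $ i)) (\<alpha> i) * z $ i ^ \<alpha> i) has_sum
     (\<Prod>i\<in>UNIV. fact (k i) * (z $ i) ^ k i / (1 - cnj (w $ i) * z $ i) ^ (k i + 1))) UNIV"
    by (intro has_sum_prod_coordinates kernel_coeff_has_sum kernel_coeff_norm_summable_on)
  then show "((\<lambda>\<alpha>. (\<Prod>i\<in>UNIV. kernel_coeff (k i) (cnj (w $ i)) (\<alpha> i)) * vmonom \<alpha> z) has_sum H2_kernel k w z) UNIV"
    using z by (simp add: vmonom_def H2_kernel_def prod.distrib)
qed

lemma H2_kernel_in_H2:
  assumes w: "w \<in> polydisk"
  shows "H2_kernel k w \<in> H2"
proof (rule H2_I[OF _ _ H2_kernel_power_series[OF w]])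
  let ?h = "\<lambda>i x. fact (k i) * x ^ k i / (1 - cnj (w $ i) * x) ^ (k i + 1)"
  have "analytic_vec_on (\<lambda>z. ?h i (z $ i)) polydisk" for i
  proof (rule analytic_vec_on_compose_holomorphic[OF analytic_vec_on_nth])
    show "?h i holomorphic_on ball 0 1"
      using one_minus_cnj_mult_nonzero[OF polydiskD[OF w, of i]] by (intro holomorphic_intros) auto
  qed (auto intro: polydiskD)
  then have "analytic_vec_on (\<lambda>z. \<Prod>i\<in>UNIV. ?h i (z $ i)) polydisk"
    by (intro analytic_vec_on_prod)
  then show "analytic_vec_on (H2_kernel k w) polydisk"
    by (rule analytic_vec_on_cong[OF open_polydisk, rotated]) (simp add: H2_kernel_def)
  let ?c = "\<lambda>\<alpha>. \<Prod>i\<in>UNIV. kernel_coeff (k i) (cnj (w $ i)) (\<alpha> i)"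
  \<comment> \<open>The one-variable series is evaluated at \<open>z = 1\<close>, where it still
    converges because \<open>norm (w $ i) < 1\<close>.\<close>
  have "(\<lambda>m. norm (kernel_coeff (k i) (cnj (w $ i)) m)) summable_on UNIV" for i
    using kernel_coeff_norm_summable_on[of "cnj (w $ i)" 1 "k i"] polydiskD[OF w] by simp
  then have c: "(\<lambda>\<alpha>. norm (?c \<alpha>)) summable_on UNIV"
    by (rule summable_on_prod_coordinates)
  \<comment> \<open>Absolute summability implies square summability, since each term is at most the
    total sum.\<close>
  show "(\<lambda>\<alpha>. (norm (?c \<alpha>))\<^sup>2) summable_on UNIV"
  proof (rule summable_on_comparison_test)
    show "(\<lambda>\<alpha>. (\<Sum>\<^sub>\<infinity>\<alpha>. norm (?c \<alpha>)) * norm (?c \<alpha>)) summable_on UNIV"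
      by (intro summable_on_cmult_right c)
    show "(norm (?c \<alpha>))\<^sup>2 \<le> (\<Sum>\<^sub>\<infinity>\<alpha>. norm (?c \<alpha>)) * norm (?c \<alpha>)" for \<alpha>
      using finite_sum_le_infsum[OF c, of "{\<alpha>}"] unfolding power2_eq_square by (intro mult_right_mono) auto
  qed auto
qed (simp add: H2_kernel_def)

text \<open>The kernel has no coefficients at exponents not dominating \<open>k\<close>. Shifting
  the remaining multi-indices by \<open>k\<close> turns the coefficient series of the inner product
  into the power series of the mixed derivative at \<open>w\<close>.\<close>

lemma H2_reproducing:
  fixes f :: "(complex, 'n::{finite,linorder}) vec \<Rightarrow> complex"
  assumes f: "f \<in> H2" and w: "w \<in> polydisk"
  shows "H2_inner f (H2_kernel k w) = mixed_partial k f w"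
proof -
  define a where "a = power_coeff f"
  have "((\<lambda>\<alpha>. a \<alpha> * cnj (\<Prod>i\<in>UNIV. kernel_coeff (k i) (cnj (w $ i)) (\<alpha> i))) has_sum H2_inner f (H2_kernel k w)) UNIV"
    using H2_inner_has_sum[OF f H2_kernel_in_H2[OF w]]
    unfolding power_coeff_eq[OF H2_kernel_power_series[OF w]] a_def .
  then have "((\<lambda>\<alpha>. a \<alpha> * cnj (\<Prod>i\<in>UNIV. kernel_coeff (k i) (cnj (w $ i)) (\<alpha> i))) has_sum H2_inner f (H2_kernel k w)) {\<alpha>. \<forall>i. k i \<le> \<alpha> i}"
    by (rule has_sum_cong_neutral[THEN iffD1, rotated 3]) (auto simp: kernel_coeff_def prod_zero_iff)
  then have "((\<lambda>\<alpha>. a (\<lambda>i. \<alpha> i + k i) * cnj (\<Prod>i\<in>UNIV. kernel_coeff (k i) (cnj (w $ i)) (\<alpha> i + k i))) has_sum H2_inner f (H2_kernel k w)) UNIV"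
    by (rule has_sum_reindex_bij_witness[where i = "\<lambda>\<alpha> i. \<alpha> i + k i" and j = "\<lambda>\<alpha> i. \<alpha> i - k i", THEN iffD1, rotated -1])
      auto
  moreover have "a (\<lambda>i. \<alpha> i + k i) * cnj (\<Prod>i\<in>UNIV. kernel_coeff (k i) (cnj (w $ i)) (\<alpha> i + k i)) =
      (\<Prod>i\<in>UNIV. fact (\<alpha> i + k i) / fact (\<alpha> i)) * a (\<lambda>i. \<alpha> i + k i) * vmonom \<alpha> w" for \<alpha>
    by (simp add: kernel_coeff_def vmonom_def prod.distrib prod_dividef flip: complex_cnj_power)
  ultimately have "((\<lambda>\<alpha>. (\<Prod>i\<in>UNIV. fact (\<alpha> i + k i) / fact (\<alpha> i)) * a (\<lambda>i. \<alpha> i + k i) * vmonom \<alpha> w) has_sum H2_inner f (H2_kernel k w)) UNIV"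
    by (simp only:)
  then show ?thesis
    using has_power_seriesD[OF has_power_series_mixed_partial[OF H2_power_series[OF f], of k] w]
    unfolding a_def by (rule has_sum_unique)
qed

section \<open>Adjoints and symmetric operators\<close>

lemma mixed_partial_zero: "mixed_partial (\<lambda>_. 0) f = f"
proof -
  have "foldr (\<lambda>i. partial_deriv i ^^ 0) xs f = f" for xs
    by (induction xs) auto
  then show ?thesis by (simp add: mixed_partial_def)
qed

text \<open>Puts \<open>f\<close> into the second slot, so that linearity of
  \<open>mixed_partial\<close> on \<open>H2\<close> can be taken from the rules for the right
  argument of \<open>H2_inner\<close>.\<close>

lemma H2_reproducing_left:
  fixes f :: "(complex, 'n::{finite,linorder}) vec \<Rightarrow> complex"
  assumes "f \<in> H2" "w \<in> polydisk"
  shows "mixed_partial k f w = cnj (H2_inner (H2_kernel k w) f)"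
  using H2_inner_cnj[OF assms(1) H2_kernel_in_H2[OF assms(2)], of k] H2_reproducing[OF assms] by simp

lemma H2_reproducing_value:
  fixes f :: "(complex, 'n::{finite,linorder}) vec \<Rightarrow> complex"
  assumes "f \<in> H2" "w \<in> polydisk"
  shows "H2_inner f (H2_kernel (\<lambda>_. 0) w) = f w"
  using H2_reproducing[OF assms, of "\<lambda>_. 0"] by (simp add: mixed_partial_zero)

lemma H2_eqI:
  fixes g h :: "(complex, 'n::{finite,linorder}) vec \<Rightarrow> complex"
  assumes g: "g \<in> H2" and h: "h \<in> H2" and eq: "\<And>f. f \<in> H2 \<Longrightarrow> H2_inner f g = H2_inner f h"
  shows "g = h"
proof
  fix z :: "(complex, 'n) vec"
  show "g z = h z"
  proof (cases "z \<in> polydisk")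
    case True
    then show ?thesis
      using eq[OF H2_kernel_in_H2[OF True, of "\<lambda>_. 0"]]
        H2_reproducing_left[OF g True, of "\<lambda>_. 0"] H2_reproducing_left[OF h True, of "\<lambda>_. 0"]
      by (simp add: mixed_partial_zero)
  qed (simp add: H2_zero g h)
qed

text \<open>Evaluates the definite description: a representing function is unique because
  \<open>H2_eqI\<close> can test equality against kernels, hence point by point.\<close>

lemma H2_adjoint_eq:
  fixes h :: "(complex, 'n::{finite,linorder}) vec \<Rightarrow> complex"
  assumes "h \<in> H2" "\<And>f. f \<in> H2 \<Longrightarrow> H2_inner (T f) g = H2_inner f h"
  shows "H2_adjoint T g = h"
  unfolding H2_adjoint_def
proof (rule the_equality)
  fix h' assume "h' \<in> H2 \<and> (\<forall>f\<in>H2. H2_inner (T f) g = H2_inner f h')"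
  then show "h' = h" using assms by (intro H2_eqI) auto
qed (use assms in auto)

text \<open>\<open>H2_inner f (T g)\<close> is expanded over the monomials. For the kernels \<open>g\<close> the expansion is a power
  series for \<open>T f\<close>, so its coefficients are the power series coefficients of \<open>T f\<close>.\<close>

lemma H2_symmetric_from_kernels:
  fixes T :: "((complex, 'n::{finite,linorder}) vec \<Rightarrow> complex) \<Rightarrow> ((complex, 'n) vec \<Rightarrow> complex)"
  assumes T: "H2_bounded T"
    and add: "\<And>f g. f \<in> H2 \<Longrightarrow> g \<in> H2 \<Longrightarrow> T (\<lambda>z. f z + g z) = (\<lambda>z. T f z + T g z)"
    and cmult: "\<And>c f. f \<in> H2 \<Longrightarrow> T (\<lambda>z. c * f z) = (\<lambda>z. c * T f z)"
    and kernels: "\<And>f w. f \<in> H2 \<Longrightarrow> w \<in> polydisk \<Longrightarrow> T f w = H2_inner f (T (H2_kernel (\<lambda>_. 0) w))"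
    and f: "f \<in> H2" and g: "g \<in> H2"
  shows "H2_inner (T f) g = H2_inner f (T g)"
proof -
  have TH2: "T h \<in> H2" if "h \<in> H2" for h
    using T that by (simp add: H2_bounded_def)
  obtain C where C: "\<And>h. h \<in> H2 \<Longrightarrow> H2_norm (T h) \<le> C * H2_norm h"
    using T by (auto simp: H2_bounded_def)
  have sum: "T (\<lambda>z. \<Sum>i\<in>X. b i * H2_monom i z) = (\<lambda>z. \<Sum>i\<in>X. b i * T (H2_monom i) z)"
    if "finite X" for X and b :: "('n \<Rightarrow> nat) \<Rightarrow> complex"
    using that
  proof (induction X)
    case empty
    then show ?case using cmult[OF H2_zero_fun, of 0] by simp
  next
    case (insert i X)
    then show ?case
      by (simp add: add cmult H2_cmult H2_sum H2_monom_in_H2)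
  qed
  have expand: "((\<lambda>\<alpha>. H2_inner f (T (H2_monom \<alpha>)) * cnj (power_coeff h \<alpha>)) has_sum H2_inner f (T h)) UNIV"
    if h: "h \<in> H2" for h
  proof -
    let ?b = "power_coeff h"
    let ?s = "\<lambda>X z. \<Sum>\<alpha>\<in>X. ?b \<alpha> * H2_monom \<alpha> z"
    let ?r = "\<lambda>X z. h z + - 1 * ?s X z"
    have s: "?s X \<in> H2" for X by (intro H2_sum H2_cmult H2_monom_in_H2)
    have r: "?r X \<in> H2" for X by (intro H2_add H2_cmult h s)
    \<comment> \<open>Boundedness enters here: the tail of the expansion of \<open>h\<close> is
      small in norm, so its image under \<open>T\<close> contributes nothing in the limit.\<close>
    have "((\<lambda>X. H2_norm f * (C * H2_norm (?r X))) \<longlongrightarrow> H2_norm f * (C * 0)) (finite_subsets_at_top UNIV)"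
      by (intro tendsto_mult tendsto_const H2_truncation_tendsto h)
    then have "((\<lambda>X. H2_norm f * (C * H2_norm (?r X))) \<longlongrightarrow> 0) (finite_subsets_at_top UNIV)"
      by simp
    then have "((\<lambda>X. H2_inner f (T (?r X))) \<longlongrightarrow> 0) (finite_subsets_at_top UNIV)"
    proof (rule Lim_null_comparison[rotated], intro always_eventually allI)
      fix X
      have "norm (H2_inner f (T (?r X))) \<le> H2_norm f * H2_norm (T (?r X))"
        by (intro H2_Cauchy_Schwarz f TH2 r)
      also have "\<dots> \<le> H2_norm f * (C * H2_norm (?r X))"
        by (intro mult_left_mono C r H2_norm_nonneg f)
      finally show "norm (H2_inner f (T (?r X))) \<le> H2_norm f * (C * H2_norm (?r X))" .
    qed
    then have lim: "((\<lambda>X. H2_inner f (T h) - H2_inner f (T (?r X))) \<longlongrightarrow> H2_inner f (T h) - 0) (finite_subsets_at_top UNIV)"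
      by (intro tendsto_diff tendsto_const)
    have "H2_inner f (T h) - H2_inner f (T (?r X)) = (\<Sum>\<alpha>\<in>X. H2_inner f (T (H2_monom \<alpha>)) * cnj (?b \<alpha>))"
      if X: "finite X" for X
    proof -
      have "T (?r X) = (\<lambda>z. T h z + - 1 * T (?s X) z)"
        using add[OF h H2_cmult[OF s], of "- 1" X] cmult[OF s, of "- 1" X] by simp
      then have "H2_inner f (T (?r X)) = H2_inner f (T h) + cnj (- 1) * H2_inner f (T (?s X))"
        by (simp only: H2_inner_add_right H2_inner_cmult_right f TH2 h s H2_cmult)
      moreover have "H2_inner f (T (?s X)) = (\<Sum>\<alpha>\<in>X. cnj (?b \<alpha>) * H2_inner f (T (H2_monom \<alpha>)))"
        unfolding sum[OF X]
        by (simp add: H2_inner_sum_right H2_inner_cmult_right f H2_cmult TH2 H2_monom_in_H2)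
      ultimately show ?thesis by (simp add: mult.commute)
    qed
    then have "\<forall>\<^sub>F X in finite_subsets_at_top UNIV. H2_inner f (T h) - H2_inner f (T (?r X)) =
        (\<Sum>\<alpha>\<in>X. H2_inner f (T (H2_monom \<alpha>)) * cnj (?b \<alpha>))"
      by (intro eventually_finite_subsets_at_top_weakI)
    from Lim_transform_eventually[OF lim this] show ?thesis
      by (simp add: has_sum_def)
  qed
  have "has_power_series (T f) (\<lambda>\<alpha>. H2_inner f (T (H2_monom \<alpha>)))"
    unfolding has_power_series_def
  proof
    fix w :: "(complex, 'n) vec" assume w: "w \<in> polydisk"
    have "cnj (power_coeff (H2_kernel (\<lambda>_. 0) w) \<alpha>) = vmonom \<alpha> w" for \<alpha>
      by (simp add: power_coeff_eq[OF H2_kernel_power_series[OF w]] kernel_coeff_def vmonom_def)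
    then show "((\<lambda>\<alpha>. H2_inner f (T (H2_monom \<alpha>)) * vmonom \<alpha> w) has_sum T f w) UNIV"
      using expand[OF H2_kernel_in_H2[OF w, of "\<lambda>_. 0"]] by (simp add: kernels[OF f w])
  qed
  then have "((\<lambda>\<alpha>. H2_inner f (T (H2_monom \<alpha>)) * cnj (power_coeff g \<alpha>)) has_sum H2_inner (T f) g) UNIV"
    using H2_inner_has_sum[OF TH2[OF f] g] by (simp add: power_coeff_eq)
  then show ?thesis using expand[OF g] by (rule has_sum_unique)
qed

section \<open>Weighted composition-differentiation operators\<close>

context
  fixes k :: "'n::{finite,linorder} \<Rightarrow> nat"
    and u :: "(complex, 'n) vec \<Rightarrow> complex"
    and V :: "(complex, 'n) vec \<Rightarrow> (complex, 'n) vec"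
  assumes V: "\<And>z. z \<in> polydisk \<Longrightarrow> V z \<in> polydisk"
begin

lemma wcd_op_add:
  assumes "f \<in> H2" "g \<in> H2"
  shows "wcd_op u V k (\<lambda>z. f z + g z) = (\<lambda>z. wcd_op u V k f z + wcd_op u V k g z)"
  using V by (auto simp: wcd_op_def fun_eq_iff H2_reproducing_left assms H2_add H2_inner_add_right H2_kernel_in_H2 ring_distribs)

lemma wcd_op_cmult:
  assumes "f \<in> H2"
  shows "wcd_op u V k (\<lambda>z. c * f z) = (\<lambda>z. c * wcd_op u V k f z)"
  using V by (auto simp: wcd_op_def fun_eq_iff H2_reproducing_left assms H2_cmult H2_inner_cmult_right H2_kernel_in_H2)

text \<open>Evaluation of the image at \<open>w\<close> is a functional on \<open>H2\<close>, and
  its representing function is the adjoint applied to the kernel at \<open>w\<close>. The scalar is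
  conjugated because it sits in the second slot.\<close>

lemma wcd_op_eq_inner:
  assumes "f \<in> H2" "w \<in> polydisk"
  shows "wcd_op u V k f w = H2_inner f (\<lambda>z. cnj (u w) * H2_kernel k (V w) z)"
  using assms V by (simp add: wcd_op_def H2_inner_cmult_right H2_kernel_in_H2 H2_reproducing)

text \<open>Reproduction is used twice: the derivative of the kernel at \<open>w\<close> is its
  inner product with \<open>H2_kernel k (V z)\<close>, and the conjugate of that inner product is
  the value of the latter kernel at \<open>w\<close>.\<close>

lemma wcd_op_kernel:
  assumes w: "w \<in> polydisk" and z: "z \<in> polydisk"
  shows "wcd_op u V k (H2_kernel (\<lambda>_. 0) w) z = u z * cnj (H2_kernel k (V z) w)"
  using H2_reproducing_value[OF H2_kernel_in_H2[OF V[OF z], of k] w]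
    H2_reproducing_left[OF H2_kernel_in_H2[OF w, of "\<lambda>_. 0"] V[OF z], of k] z
  by (simp add: wcd_op_def)

text \<open>The two sides of the equation are the adjoint and the operator itself, both applied to
  the kernel at \<open>w\<close> and evaluated at \<open>z\<close>. Conversely, equality on kernels
  is the hypothesis under which \<open>H2_symmetric_from_kernels\<close> gives symmetry on all of
  \<open>H2\<close>.\<close>

lemma hermitian_iff_kernel_symmetric:
  assumes bounded: "H2_bounded (wcd_op u V k)"
  shows "H2_hermitian (wcd_op u V k) \<longleftrightarrow>
    (\<forall>w\<in>polydisk. \<forall>z\<in>polydisk. cnj (u w) * H2_kernel k (V w) z = u z * cnj (H2_kernel k (V z) w))"
    (is "_ \<longleftrightarrow> ?symmetric")
proof
  let ?T = "wcd_op u V k" and ?K = "H2_kernel (\<lambda>_. 0)"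
  have TH2: "?T f \<in> H2" if "f \<in> H2" for f
    using bounded that by (simp add: H2_bounded_def)
  {
    assume herm: "H2_hermitian ?T"
    show ?symmetric
    proof (intro ballI)
      fix w z :: "(complex, 'n) vec" assume w: "w \<in> polydisk" and z: "z \<in> polydisk"
      have "H2_adjoint ?T (?K w) = (\<lambda>z. cnj (u w) * H2_kernel k (V w) z)"
        using w V by (intro H2_adjoint_eq H2_cmult H2_kernel_in_H2)
          (auto simp: H2_reproducing_value TH2 wcd_op_eq_inner)
      moreover have "H2_adjoint ?T (?K w) = ?T (?K w)"
        using herm H2_kernel_in_H2[OF w] by (simp add: H2_hermitian_def)
      ultimately show "cnj (u w) * H2_kernel k (V w) z = u z * cnj (H2_kernel k (V z) w)"
        using wcd_op_kernel[OF w z] by metis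
    qed
  }
  assume sym: ?symmetric
  have "?T f w = H2_inner f (?T (?K w))" if f: "f \<in> H2" and w: "w \<in> polydisk" for f w
  proof -
    have "?T (?K w) = (\<lambda>z. cnj (u w) * H2_kernel k (V w) z)"
    proof
      fix z
      show "?T (?K w) z = cnj (u w) * H2_kernel k (V w) z"
      proof (cases "z \<in> polydisk")
        case True
        then show ?thesis using sym w wcd_op_kernel[OF w True] by simp
      qed (simp add: wcd_op_def H2_kernel_def)
    qed
    then show ?thesis using wcd_op_eq_inner[OF f w] by simp
  qed
  then have "H2_inner (?T f) g = H2_inner f (?T g)" if "f \<in> H2" "g \<in> H2" for f g
    using that by (intro H2_symmetric_from_kernels bounded wcd_op_add wcd_op_cmult)
  then show "H2_hermitian ?T"
    unfolding H2_hermitian_def using bounded TH2 by (auto intro!: H2_adjoint_eq)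
qed

end

section \<open>Solving the kernel equation\<close>

text \<open>The quotient of \<open>p\<close> by \<open>q\<close> is continuous on the connected disk
  and takes values among finitely many roots of unity. It is therefore constant, and the value at 0
  makes it 1.\<close>

lemma power_eq_on_disk:
  fixes p q :: "complex \<Rightarrow> complex"
  assumes p: "continuous_on (ball 0 1) p" and q: "continuous_on (ball 0 1) q"
    and nz: "\<And>x. x \<in> ball 0 1 \<Longrightarrow> q x \<noteq> 0" and pw: "\<And>x. x \<in> ball 0 1 \<Longrightarrow> p x ^ Suc m = q x ^ Suc m"
    and zero: "p 0 = q 0" and x: "x \<in> ball 0 1"
  shows "p x = q x"
proof -
  let ?f = "\<lambda>x. p x / q x"
  have "?f ` ball 0 1 \<subseteq> {z. z ^ Suc m = 1}"
    using nz pw by (auto simp: power_divide simp del: power_Suc)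
  then have "finite (?f ` ball 0 1)"
    by (rule finite_subset) (rule finite_roots_unity, simp)
  moreover have "continuous_on (ball 0 1) ?f"
    by (intro continuous_on_divide p q) (use nz in auto)
  ultimately have "?f constant_on ball 0 1"
    by (intro continuous_finite_range_constant) auto
  then have "?f x = ?f 0"
    using x unfolding constant_on_def by (metis centre_in_ball zero_less_one)
  then show ?thesis using zero nz[OF x] nz[of 0] by simp
qed

text \<open>For fixed \<open>y\<close> the equation is linear in \<open>v x\<close>, so a single
  nonzero \<open>y\<close> already exhibits \<open>v\<close> as a fractional linear map. The
  identity behind the reality of its coefficient comes from setting \<open>x\<close> equal to that
  \<open>y\<close>.\<close>

lemma disk_symbol_form:
  fixes v :: "complex \<Rightarrow> complex" and c :: complex
  assumes c: "norm c < 1"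
    and eq: "\<And>x y. x \<in> ball 0 1 \<Longrightarrow> y \<in> ball 0 1 \<Longrightarrow>
      (1 - c * cnj y) * (1 - cnj (v y) * x) = (1 - cnj c * x) * (1 - v x * cnj y)"
  shows "\<exists>d::real. \<forall>x\<in>ball 0 1. v x = ((of_real d - of_real ((norm c)\<^sup>2)) * x + c) / (1 - cnj c * x)"
proof -
  \<comment> \<open>The coefficient of \<open>x\<close> when the equation at \<open>y = 1/2\<close>
    is solved for \<open>v x * (1 - cnj c * x)\<close>. In the end
    \<open>d = e + |c|^2\<close>.\<close>
  define e where "e = 2 * ((1 - c / 2) * cnj (v (1/2)) - cnj c)"
  have vx: "v x * (1 - cnj c * x) = c + e * x" if "x \<in> ball 0 1" for x
    using eq[OF that, of "1/2"] unfolding e_def by (simp add: field_simps)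
  \<comment> \<open>Conjugating this instance expresses \<open>cnj (v (1/2))\<close> through
    \<open>cnj e\<close>; substitution into the definition of \<open>e\<close> gives
    \<open>e = cnj e\<close>.\<close>
  have "v (1/2) * (1 - cnj c / 2) = c + e / 2"
    using vx[of "1/2"] by simp
  then have "cnj (v (1/2) * (1 - cnj c / 2)) = cnj (c + e / 2)"
    by (rule arg_cong)
  then have "(1 - c / 2) * cnj (v (1/2)) = cnj c + cnj e / 2"
    by (simp add: mult.commute)
  then have "e = cnj e" unfolding e_def by simp
  then have e: "of_real (Re e) = e"
    by (metis Reals_cnj_iff of_real_Re)
  have "v x = ((of_real (Re e + (norm c)\<^sup>2) - of_real ((norm c)\<^sup>2)) * x + c) / (1 - cnj c * x)" if "x \<in> ball 0 1" for x
  proof -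
    have "1 - cnj c * x \<noteq> 0"
      using that by (intro one_minus_cnj_mult_nonzero c) auto
    then show ?thesis using vx[OF that] e by (simp add: field_simps)
  qed
  then show ?thesis by blast
qed

text \<open>With the denominators of \<open>v\<close> cleared, both sides equal
  \<open>1 - c * cnj y - cnj c * x - (d - |c|^2) * x * cnj y\<close>. The symmetry rests on
  \<open>d\<close> being real.\<close>

lemma symbol_kernel_identity:
  fixes c x y :: complex and d :: real
  defines "v \<equiv> \<lambda>x. ((of_real d - of_real ((norm c)\<^sup>2)) * x + c) / (1 - cnj c * x)"
  assumes c: "norm c < 1" and "norm x < 1" "norm y < 1"
  shows "(1 - c * cnj y) * (1 - cnj (v y) * x) = (1 - cnj c * x) * (1 - v x * cnj y)"
proof -
  have x: "1 - cnj c * x \<noteq> 0" and y: "1 - cnj c * y \<noteq> 0"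
    by (rule one_minus_cnj_mult_nonzero[OF c], fact)+
  have "cnj (1 - cnj c * y) \<noteq> 0" using y by (simp only: complex_cnj_zero_iff not_False_eq_True)
  then have y': "1 - c * cnj y \<noteq> 0" by simp
  have "(1 - c * cnj y) * (1 - cnj (v y) * x) = (1 - c * cnj y) - (1 - c * cnj y) * cnj (v y) * x"
    by (simp add: algebra_simps)
  also have "(1 - c * cnj y) * cnj (v y) = (of_real d - of_real ((norm c)\<^sup>2)) * cnj y + cnj c"
    using y' by (simp add: v_def)
  also have "(1 - c * cnj y) - ((of_real d - of_real ((norm c)\<^sup>2)) * cnj y + cnj c) * x =
      (1 - cnj c * x) - ((of_real d - of_real ((norm c)\<^sup>2)) * x + c) * cnj y"
    by (simp add: algebra_simps)
  also have "(of_real d - of_real ((norm c)\<^sup>2)) * x + c = (1 - cnj c * x) * v x"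
    using x by (simp add: v_def)
  also have "(1 - cnj c * x) - (1 - cnj c * x) * v x * cnj y = (1 - cnj c * x) * (1 - v x * cnj y)"
    by (simp add: algebra_simps)
  finally show ?thesis .
qed

section \<open>Approximation by points without vanishing coordinates\<close>

text \<open>A small positive shift along the diagonal moves every coordinate off 0 at once: a zero
  coordinate becomes \<open>t\<close>, and a nonzero one stays nonzero.\<close>

definition shift_diag :: "complex ^ 'n::finite \<Rightarrow> real \<Rightarrow> complex ^ 'n" where
  "shift_diag z t = (\<chi> i. z $ i + of_real t)"

lemma shift_diag_nth [simp]: "shift_diag z t $ i = z $ i + of_real t"
  by (simp add: shift_diag_def)

lemma tendsto_shift_diag: "(shift_diag z \<longlongrightarrow> z) (at_right 0)"
proof (rule vec_tendstoI)
  fix i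
  have "((\<lambda>t. z $ i + of_real t) \<longlongrightarrow> z $ i + of_real 0) (at_right 0)"
    by (intro tendsto_intros)
  then show "((\<lambda>t. shift_diag z t $ i) \<longlongrightarrow> z $ i) (at_right 0)" by simp
qed

lemma eventually_shift_diag_in_polydisk:
  assumes "z \<in> polydisk"
  shows "\<forall>\<^sub>F t in at_right 0. shift_diag z t \<in> polydisk"
  using topological_tendstoD[OF tendsto_shift_diag open_polydisk assms] .

lemma eventually_shift_diag_nonzero: "\<forall>\<^sub>F t in at_right 0. \<forall>i. shift_diag z t $ i \<noteq> 0"
proof (rule eventually_all_finite)
  fix i
  show "\<forall>\<^sub>F t in at_right 0. shift_diag z t $ i \<noteq> 0"
  proof (cases "z $ i = 0")
    case True
    show ?thesis
      using eventually_at_right_less[of "0::real"] by (rule eventually_mono) (simp add: True)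
  next
    case False
    have "((\<lambda>t. shift_diag z t $ i) \<longlongrightarrow> z $ i) (at_right 0)"
      by (intro tendsto_vec_nth tendsto_shift_diag)
    then show ?thesis using False by (rule tendsto_imp_eventually_ne)
  qed
qed

lemma exists_nonzero_coordinates:
  fixes u :: "complex ^ 'n::finite \<Rightarrow> complex"
  assumes u: "continuous_on polydisk u" and z: "z \<in> polydisk" "u z \<noteq> 0"
  obtains w where "w \<in> polydisk" "u w \<noteq> 0" "\<And>i. w $ i \<noteq> 0"
proof -
  have "isCont u z"
    using u z(1) by (simp add: continuous_on_eq_continuous_at[OF open_polydisk])
  then have "((\<lambda>t. u (shift_diag z t)) \<longlongrightarrow> u z) (at_right 0)"
    using tendsto_shift_diag by (rule isCont_tendsto_compose)
  then have "\<forall>\<^sub>F t in at_right 0. u (shift_diag z t) \<noteq> 0"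
    using z(2) by (rule tendsto_imp_eventually_ne)
  then have "\<forall>\<^sub>F t in at_right 0. shift_diag z t \<in> polydisk \<and> u (shift_diag z t) \<noteq> 0 \<and> (\<forall>i. shift_diag z t $ i \<noteq> 0)"
    by (intro eventually_conj eventually_shift_diag_in_polydisk eventually_shift_diag_nonzero z)
  then obtain t where "shift_diag z t \<in> polydisk \<and> u (shift_diag z t) \<noteq> 0 \<and> (\<forall>i. shift_diag z t $ i \<noteq> 0)"
    using eventually_happens'[OF trivial_limit_at_right_real] by blast
  then show thesis by (intro that) auto
qed

context
  fixes k :: "'n::{finite,linorder} \<Rightarrow> nat"
    and u :: "(complex, 'n) vec \<Rightarrow> complex"
    and v :: "'n \<Rightarrow> complex \<Rightarrow> complex"
  assumes u: "continuous_on polydisk u" "\<exists>z\<in>polydisk. u z \<noteq> 0"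
    and v: "\<And>j. v j holomorphic_on ball 0 1" "\<And>j. v j ` ball 0 1 \<subseteq> ball 0 1"
begin

section \<open>The kernel equation for coordinatewise symbols\<close>

definition kernel_denom :: "(complex, 'n) vec \<Rightarrow> (complex, 'n) vec \<Rightarrow> complex" where
  "kernel_denom b z = (\<Prod>i\<in>UNIV. (1 - cnj (b $ i) * z $ i) ^ (k i + 1))"

abbreviation (input) coord_map :: "(complex, 'n) vec \<Rightarrow> (complex, 'n) vec" where
  "coord_map z \<equiv> \<chi> j. v j (z $ j)"

lemma norm_v: "norm x < 1 \<Longrightarrow> norm (v j x) < 1"
  using v(2)[of j] by (auto simp: image_subset_iff)

lemma V_in_polydisk: "z \<in> polydisk \<Longrightarrow> coord_map z \<in> polydisk"
  by (simp add: polydisk_def norm_v)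

lemma kernel_denom_nonzero: "b \<in> polydisk \<Longrightarrow> z \<in> polydisk \<Longrightarrow> kernel_denom b z \<noteq> 0"
  unfolding kernel_denom_def using one_minus_cnj_mult_nonzero polydiskD by simp blast

lemma kernel_denom_zero: "kernel_denom b 0 = 1"
  by (simp add: kernel_denom_def)

text \<open>On a coordinate axis all other factors are 1. This decouples the equation for the
  product into one equation for each \<open>v j\<close>.\<close>

lemma kernel_denom_axis: "kernel_denom b (axis j x) = (1 - cnj (b $ j) * x) ^ (k j + 1)"
proof -
  have "kernel_denom b (axis j x) = (\<Prod>i\<in>UNIV. if i = j then (1 - cnj (b $ j) * x) ^ (k j + 1) else 1)"
    unfolding kernel_denom_def by (intro prod.cong) (auto simp: axis_def)
  then show ?thesis by simp
qed

lemma axis_in_polydisk: "norm x < 1 \<Longrightarrow> axis j x \<in> polydisk"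
  by (simp add: polydisk_def axis_def)

lemma H2_kernel_eq: "z \<in> polydisk \<Longrightarrow> H2_kernel k b z = (\<Prod>i\<in>UNIV. fact (k i)) * vmonom k z / kernel_denom b z"
  by (simp add: H2_kernel_def kernel_denom_def vmonom_def prod.distrib prod_dividef)

text \<open>Clears the nonvanishing denominators and cancels the product of factorials, which is
  real and so agrees on both sides. The cleared form is polynomial in the kernels' denominators and
  passes to limits directly.\<close>

lemma kernel_symmetric_iff:
  assumes w: "w \<in> polydisk" and z: "z \<in> polydisk"
  shows "cnj (u w) * H2_kernel k (coord_map w) z = u z * cnj (H2_kernel k (coord_map z) w) \<longleftrightarrow>
    cnj (u w) * vmonom k z * cnj (kernel_denom (coord_map z) w) = u z * cnj (vmonom k w) * kernel_denom (coord_map w) z"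
proof -
  define F :: complex where "F = (\<Prod>i\<in>UNIV. fact (k i))"
  have F: "F \<noteq> 0" "cnj F = F" by (auto simp: F_def)
  define A B where "A = kernel_denom (coord_map w) z" and "B = cnj (kernel_denom (coord_map z) w)"
  have AB: "A \<noteq> 0" "B \<noteq> 0"
    unfolding A_def B_def complex_cnj_zero_iff by (intro kernel_denom_nonzero V_in_polydisk w z)+
  have "cnj (u w) * H2_kernel k (coord_map w) z = F * (cnj (u w) * vmonom k z / A)"
    by (simp add: H2_kernel_eq z F_def A_def)
  moreover have "u z * cnj (H2_kernel k (coord_map z) w) = F * (u z * cnj (vmonom k w) / B)"
    using F(2) by (simp add: H2_kernel_eq w F_def B_def)
  ultimately show ?thesis
    unfolding A_def[symmetric] B_def[symmetric] using F AB by (simp add: frac_eq_eq mult.assoc)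
qed

lemma tendsto_kernel_denom:
  assumes b: "(b \<longlongrightarrow> b0) F" and z: "(z \<longlongrightarrow> z0) F"
  shows "((\<lambda>t. kernel_denom (b t) (z t)) \<longlongrightarrow> kernel_denom b0 z0) F"
  unfolding kernel_denom_def
  by (intro tendsto_prod tendsto_power tendsto_diff tendsto_const tendsto_mult tendsto_cnj tendsto_vec_nth b z)

lemma tendsto_V:
  assumes "(z \<longlongrightarrow> z0) F" "z0 \<in> polydisk"
  shows "((\<lambda>t. coord_map (z t)) \<longlongrightarrow> coord_map z0) F"
proof (rule vec_tendstoI)
  fix j
  have "isCont (v j) (z0 $ j)"
    using holomorphic_on_imp_continuous_on[OF v(1)[of j]] polydiskD[OF assms(2)]
    by (simp add: continuous_on_eq_continuous_at)
  then have "((\<lambda>t. v j (z t $ j)) \<longlongrightarrow> v j (z0 $ j)) F"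
    by (rule isCont_tendsto_compose) (intro tendsto_vec_nth assms)
  then show "((\<lambda>t. coord_map (z t) $ j) \<longlongrightarrow> coord_map z0 $ j) F" by simp
qed

lemma vmonom_nonzero: "(\<And>i. z $ i \<noteq> 0) \<Longrightarrow> vmonom \<alpha> z \<noteq> 0"
  by (simp add: vmonom_def)

text \<open>Fixing one argument \<open>w0\<close> shows that the monomial divides \<open>u\<close>. The quotient \<open>g\<close> satisfies the
  equation without the monomials, first where no coordinate vanishes and then, by continuity,
  everywhere; it can thus be evaluated at \<open>0\<close>.\<close>

lemma kernel_symmetric_solution:
  assumes sym: "\<And>w z. w \<in> polydisk \<Longrightarrow> z \<in> polydisk \<Longrightarrow>
    cnj (u w) * vmonom k z * cnj (kernel_denom (coord_map z) w) = u z * cnj (vmonom k w) * kernel_denom (coord_map w) z"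
  shows "\<exists>a::real. (\<forall>z\<in>polydisk. u z = of_real a * (vmonom k z / kernel_denom (coord_map 0) z)) \<and>
    (\<forall>w\<in>polydisk. \<forall>z\<in>polydisk. cnj (kernel_denom (coord_map 0) w) * kernel_denom (coord_map w) z =
      kernel_denom (coord_map 0) z * cnj (kernel_denom (coord_map z) w))"
proof -
  obtain w0 where w0: "w0 \<in> polydisk" "u w0 \<noteq> 0" "\<And>i. w0 $ i \<noteq> 0"
    using u exists_nonzero_coordinates by metis
  \<comment> \<open>The equation at \<open>w0\<close>, solved for \<open>u z\<close> and divided by
    \<open>vmonom k z\<close>. The formula makes sense, and is continuous, also where the monomial
    vanishes.\<close>
  define g where "g z = cnj (u w0) / cnj (vmonom k w0) * cnj (kernel_denom (coord_map z) w0) / kernel_denom (coord_map w0) z" for z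
  have u_eq: "u z = g z * vmonom k z" if "z \<in> polydisk" for z
  proof -
    have "cnj (vmonom k w0) \<noteq> 0" using vmonom_nonzero[OF w0(3)] by simp
    moreover have "kernel_denom (coord_map w0) z \<noteq> 0"
      using that w0 by (intro kernel_denom_nonzero V_in_polydisk)
    ultimately show ?thesis
      using sym[OF w0(1) that] by (simp add: g_def field_simps)
  qed
  have g_nz: "cnj (g w) * cnj (kernel_denom (coord_map z) w) = g z * kernel_denom (coord_map w) z"
    if "w \<in> polydisk" "z \<in> polydisk" "\<And>i. w $ i \<noteq> 0" "\<And>i. z $ i \<noteq> 0" for w z
  proof -
    have nz: "cnj (vmonom k w) * vmonom k z \<noteq> 0"
      using vmonom_nonzero[OF that(3)] vmonom_nonzero[OF that(4)] by simp
    have "(cnj (vmonom k w) * vmonom k z) * (cnj (g w) * cnj (kernel_denom (coord_map z) w)) =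
        (cnj (vmonom k w) * vmonom k z) * (g z * kernel_denom (coord_map w) z)"
      using sym[OF that(1,2)] unfolding u_eq[OF that(1)] u_eq[OF that(2)] complex_cnj_mult by (simp only: mult_ac)
    then show ?thesis using nz by (simp only: mult_cancel_left) simp
  qed
  have tendsto_g: "((\<lambda>t. g (shift_diag z t)) \<longlongrightarrow> g z) (at_right 0)" if z: "z \<in> polydisk" for z
    unfolding g_def
    by (intro tendsto_divide tendsto_mult tendsto_const tendsto_cnj tendsto_kernel_denom tendsto_V
        tendsto_shift_diag z kernel_denom_nonzero V_in_polydisk w0)
  have g_sym: "cnj (g w) * cnj (kernel_denom (coord_map z) w) = g z * kernel_denom (coord_map w) z"
    if w: "w \<in> polydisk" and z: "z \<in> polydisk" for w z
  proof (rule tendsto_unique[OF trivial_limit_at_right_real])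
    show "((\<lambda>t. cnj (g (shift_diag w t)) * cnj (kernel_denom (coord_map (shift_diag z t)) (shift_diag w t))) \<longlongrightarrow>
        cnj (g w) * cnj (kernel_denom (coord_map z) w)) (at_right 0)"
      by (intro tendsto_mult tendsto_cnj tendsto_g tendsto_kernel_denom tendsto_V tendsto_shift_diag w z)
    have "((\<lambda>t. g (shift_diag z t) * kernel_denom (coord_map (shift_diag w t)) (shift_diag z t)) \<longlongrightarrow>
        g z * kernel_denom (coord_map w) z) (at_right 0)"
      by (intro tendsto_mult tendsto_g tendsto_kernel_denom tendsto_V tendsto_shift_diag w z)
    moreover have "\<forall>\<^sub>F t in at_right 0. g (shift_diag z t) * kernel_denom (coord_map (shift_diag w t)) (shift_diag z t) =
      cnj (g (shift_diag w t)) * cnj (kernel_denom (coord_map (shift_diag z t)) (shift_diag w t))"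
      using eventually_shift_diag_in_polydisk[OF w] eventually_shift_diag_in_polydisk[OF z]
        eventually_shift_diag_nonzero[of w] eventually_shift_diag_nonzero[of z]
    proof eventually_elim
      case (elim t)
      show ?case by (rule g_nz[symmetric]) (use elim in blast)+
    qed
    ultimately show "((\<lambda>t. cnj (g (shift_diag w t)) * cnj (kernel_denom (coord_map (shift_diag z t)) (shift_diag w t))) \<longlongrightarrow>
        g z * kernel_denom (coord_map w) z) (at_right 0)"
      by (rule Lim_transform_eventually)
  qed
  \<comment> \<open>At \<open>w = z = 0\<close> both denominators are 1, so the constant
    \<open>g 0\<close>, which becomes \<open>a\<close>, is real.\<close>
  have g0: "cnj (g 0) = g 0"
    using g_sym[OF zero_in_polydisk zero_in_polydisk] by (simp add: kernel_denom_zero)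
  have g: "g 0 = g z * kernel_denom (coord_map 0) z" if "z \<in> polydisk" for z
    using g_sym[OF zero_in_polydisk that] by (simp add: kernel_denom_zero g0)
  have V0: "coord_map 0 \<in> polydisk" by (intro V_in_polydisk zero_in_polydisk)
  have g0_nz: "g 0 \<noteq> 0"
    using g[OF w0(1)] u_eq[OF w0(1)] w0(2) kernel_denom_nonzero[OF V0 w0(1)] by auto
  show ?thesis
  proof (intro exI conjI ballI)
    fix z :: "(complex, 'n) vec" assume z: "z \<in> polydisk"
    have "of_real (Re (g 0)) = g 0"
      using g0 by (metis Reals_cnj_iff of_real_Re)
    then show "u z = of_real (Re (g 0)) * (vmonom k z / kernel_denom (coord_map 0) z)"
      using g[OF z] kernel_denom_nonzero[OF V0 z] by (simp add: u_eq[OF z])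
  next
    fix w z :: "(complex, 'n) vec" assume w: "w \<in> polydisk" and z: "z \<in> polydisk"
    have "cnj (g 0) = cnj (g w) * cnj (kernel_denom (coord_map 0) w)"
      unfolding complex_cnj_mult[symmetric] g[OF w, symmetric] ..
    then have gw: "g 0 = cnj (g w) * cnj (kernel_denom (coord_map 0) w)"
      by (simp only: g0)
    \<comment> \<open>To eliminate \<open>g\<close>, the constant \<open>g 0\<close> is rewritten
      through \<open>z\<close>, the symmetry of \<open>g\<close> is applied, and the factor
      depending on \<open>w\<close> is folded back into \<open>g 0\<close>, which is nonzero and
      cancels.\<close>
    have "g 0 * (cnj (kernel_denom (coord_map 0) w) * kernel_denom (coord_map w) z) =
      (g z * kernel_denom (coord_map w) z) * kernel_denom (coord_map 0) z * cnj (kernel_denom (coord_map 0) w)"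
      using g[OF z] by (simp only: mult_ac)
    also have "\<dots> = (cnj (g w) * cnj (kernel_denom (coord_map 0) w)) * (kernel_denom (coord_map 0) z * cnj (kernel_denom (coord_map z) w))"
      unfolding g_sym[OF w z, symmetric] by (simp only: mult_ac)
    also have "\<dots> = g 0 * (kernel_denom (coord_map 0) z * cnj (kernel_denom (coord_map z) w))"
      by (simp only: gw[symmetric])
    finally show "cnj (kernel_denom (coord_map 0) w) * kernel_denom (coord_map w) z = kernel_denom (coord_map 0) z * cnj (kernel_denom (coord_map z) w)"
      using g0_nz by (simp only: mult_cancel_left) simp
  qed
qed

text \<open>On the \<open>j\<close>-th axis the equation equates powers with exponent
  \<open>k j + 1\<close>. For fixed \<open>y\<close> the bases agree at \<open>x = 0\<close>, both
  being \<open>1 - v j 0 * cnj y\<close>, so the roots can be compared on the whole disk.\<close>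

lemma kernel_denom_symmetric_imp_disk_symbol:
  assumes sym: "\<And>w z. w \<in> polydisk \<Longrightarrow> z \<in> polydisk \<Longrightarrow>
    cnj (kernel_denom (coord_map 0) w) * kernel_denom (coord_map w) z = kernel_denom (coord_map 0) z * cnj (kernel_denom (coord_map z) w)"
  shows "\<exists>d::real. \<forall>x\<in>ball 0 1. v j x =
    ((of_real d - of_real ((norm (v j 0))\<^sup>2)) * x + v j 0) / (1 - cnj (v j 0) * x)"
proof (rule disk_symbol_form)
  let ?c = "v j 0"
  show c: "norm ?c < 1" by (intro norm_v) simp
  fix x y :: complex assume x: "x \<in> ball 0 1" and y: "y \<in> ball 0 1"
  let ?p = "\<lambda>x. (1 - ?c * cnj y) * (1 - cnj (v j y) * x)"
  let ?q = "\<lambda>x. (1 - cnj ?c * x) * (1 - v j x * cnj y)"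
  show "?p x = ?q x"
  proof (rule power_eq_on_disk[OF _ _ _ _ _ x])
    show "continuous_on (ball 0 1) ?p" by (intro continuous_intros)
    show "continuous_on (ball 0 1) ?q"
      by (intro continuous_intros holomorphic_on_imp_continuous_on v)
    fix x :: complex assume x: "x \<in> ball 0 1"
    have "1 - v j x * cnj y \<noteq> 0"
      using one_minus_cnj_mult_nonzero[of y "v j x"] x y norm_v[of x j] by (simp add: mult.commute)
    moreover have "1 - cnj ?c * x \<noteq> 0"
      using one_minus_cnj_mult_nonzero[OF c, of x] x by simp
    ultimately show "?q x \<noteq> 0" by simp
    have "axis j x \<in> polydisk" "axis j y \<in> polydisk"
      using x y by (auto intro!: axis_in_polydisk)
    \<comment> \<open>Off \<open>j\<close> the coordinates of \<open>coord_map (axis j y)\<close>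
      are \<open>v i 0\<close>, possibly nonzero, but each is paired with a zero coordinate of the
      other argument.\<close>
    from sym[OF this(2,1)]
    show "?p x ^ Suc (k j) = ?q x ^ Suc (k j)"
      unfolding kernel_denom_axis by (simp add: axis_def power_mult_distrib del: power_Suc)
  qed simp
qed

text \<open>The identity holds factor by factor: each factor is a power of the one-variable identity
  for the fractional linear form.\<close>

lemma disk_symbol_imp_kernel_denom_symmetric:
  assumes "\<And>j x. x \<in> ball 0 1 \<Longrightarrow> v j x =
      ((of_real (d j) - of_real ((norm (c j))\<^sup>2)) * x + c j) / (1 - cnj (c j) * x)"
    and c: "\<And>j. norm (c j) < 1" and w: "w \<in> polydisk" and z: "z \<in> polydisk"
  shows "cnj (kernel_denom (\<chi> i. c i) w) * kernel_denom (coord_map w) z =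
    kernel_denom (\<chi> i. c i) z * cnj (kernel_denom (coord_map z) w)"
  unfolding kernel_denom_def cnj_prod prod.distrib[symmetric]
proof (rule prod.cong[OF refl])
  fix i
  have "(1 - c i * cnj (w $ i)) * (1 - cnj (v i (w $ i)) * z $ i) = (1 - cnj (c i) * z $ i) * (1 - v i (z $ i) * cnj (w $ i))"
    using symbol_kernel_identity[where d = "d i", OF c[of i] polydiskD[OF z, of i] polydiskD[OF w, of i]] polydiskD[OF w, of i] polydiskD[OF z, of i]
    by (simp add: assms(1))
  then have "((1 - c i * cnj (w $ i)) * (1 - cnj (v i (w $ i)) * z $ i)) ^ (k i + 1) =
    ((1 - cnj (c i) * z $ i) * (1 - v i (z $ i) * cnj (w $ i))) ^ (k i + 1)" by (rule arg_cong)
  then show "cnj ((1 - cnj ((\<chi> i. c i) $ i) * w $ i) ^ (k i + 1)) * (1 - cnj (coord_map w $ i) * z $ i) ^ (k i + 1) =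
    (1 - cnj ((\<chi> i. c i) $ i) * z $ i) ^ (k i + 1) * cnj ((1 - cnj (coord_map z $ i) * w $ i) ^ (k i + 1))"
    unfolding power_mult_distrib by simp
qed

lemma kernel_symmetric_iff_form:
  "(\<forall>w\<in>polydisk. \<forall>z\<in>polydisk. cnj (u w) * H2_kernel k (coord_map w) z = u z * cnj (H2_kernel k (coord_map z) w)) \<longleftrightarrow>
   (\<exists>(a::real) (d :: 'n \<Rightarrow> real) (c :: 'n \<Rightarrow> complex).
       (\<forall>z\<in>polydisk. u z =
          of_real a * (\<Prod>i\<in>UNIV. (z $ i) ^ k i / (1 - cnj (c i) * z $ i) ^ (k i + 1))) \<and>
       (\<forall>j. \<forall>w\<in>ball 0 1. v j w =
          ((of_real (d j) - of_real ((norm (c j))\<^sup>2)) * w + c j) / (1 - cnj (c j) * w)))"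
    (is "?sym \<longleftrightarrow> ?form")
proof
  have form: "(\<Prod>i\<in>UNIV. (z $ i) ^ k i / (1 - cnj (c i) * z $ i) ^ (k i + 1)) = vmonom k z / kernel_denom (\<chi> i. c i) z" for z c
    by (simp add: vmonom_def kernel_denom_def prod_dividef)
  {
    assume ?sym
    then have s: "cnj (u w) * vmonom k z * cnj (kernel_denom (coord_map z) w) = u z * cnj (vmonom k w) * kernel_denom (coord_map w) z"
      if "w \<in> polydisk" "z \<in> polydisk" for w z
      using kernel_symmetric_iff[OF that] that by blast
    obtain a :: real where a: "\<forall>z\<in>polydisk. u z = of_real a * (vmonom k z / kernel_denom (coord_map 0) z)"
      and sym: "\<forall>w\<in>polydisk. \<forall>z\<in>polydisk. cnj (kernel_denom (coord_map 0) w) * kernel_denom (coord_map w) z =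
        kernel_denom (coord_map 0) z * cnj (kernel_denom (coord_map z) w)"
      using kernel_symmetric_solution[OF s] by auto
    have "\<forall>j. \<exists>d::real. \<forall>x\<in>ball 0 1. v j x =
        ((of_real d - of_real ((norm (v j 0))\<^sup>2)) * x + v j 0) / (1 - cnj (v j 0) * x)"
      using sym by (intro allI kernel_denom_symmetric_imp_disk_symbol) blast
    then obtain d :: "'n \<Rightarrow> real" where d: "\<forall>j. \<forall>x\<in>ball 0 1. v j x =
        ((of_real (d j) - of_real ((norm (v j 0))\<^sup>2)) * x + v j 0) / (1 - cnj (v j 0) * x)"
      by (rule choice[THEN exE])
    have "coord_map 0 = (\<chi> j. v j 0)" by simp
    with a have "\<forall>z\<in>polydisk. u z = of_real a * (vmonom k z / kernel_denom (\<chi> j. v j 0) z)"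
      by (simp only:)
    then show ?form
      unfolding form using d by (intro exI[of _ a] exI[of _ d] exI[of _ "\<lambda>j. v j 0"] conjI)
  }
  assume ?form
  then obtain a :: real and d :: "'n \<Rightarrow> real" and c where
    u_eq: "\<And>z. z \<in> polydisk \<Longrightarrow> u z = of_real a * (vmonom k z / kernel_denom (\<chi> i. c i) z)" and
    v_eq: "\<And>j x. x \<in> ball 0 1 \<Longrightarrow> v j x =
          ((of_real (d j) - of_real ((norm (c j))\<^sup>2)) * x + c j) / (1 - cnj (c j) * x)"
    unfolding form by blast
  \<comment> \<open>The bound is not part of the form: it holds since \<open>c j\<close> is the
    value at 0 of a self-map of the disk.\<close>
  have c: "norm (c j) < 1" for j
    using v_eq[of 0 j] norm_v[of 0 j] by simp
  then have cp: "(\<chi> i. c i) \<in> polydisk" by (simp add: polydisk_def)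
  show ?sym
  proof (intro ballI)
    fix w z :: "(complex, 'n) vec" assume w: "w \<in> polydisk" and z: "z \<in> polydisk"
    let ?D = "kernel_denom (\<chi> i. c i)"
    have D: "?D z \<noteq> 0" "cnj (?D w) \<noteq> 0"
      using kernel_denom_nonzero[OF cp] w z by auto
    have "cnj (?D w) * kernel_denom (coord_map w) z = ?D z * cnj (kernel_denom (coord_map z) w)"
      by (rule disk_symbol_imp_kernel_denom_symmetric[OF v_eq c w z])
    then have "cnj (kernel_denom (coord_map z) w) / cnj (?D w) = kernel_denom (coord_map w) z / ?D z"
      using D by (simp add: frac_eq_eq mult.commute)
    \<comment> \<open>Since \<open>a\<close> is real, it is the common scalar of \<open>u z\<close>
      and \<open>cnj (u w)\<close>; what remains is the identity of the denominators.\<close>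
    then have "of_real a * cnj (vmonom k w) * vmonom k z * (cnj (kernel_denom (coord_map z) w) / cnj (?D w)) =
        of_real a * cnj (vmonom k w) * vmonom k z * (kernel_denom (coord_map w) z / ?D z)"
      by (rule arg_cong)
    then have "cnj (u w) * vmonom k z * cnj (kernel_denom (coord_map z) w) = u z * cnj (vmonom k w) * kernel_denom (coord_map w) z"
      by (simp add: u_eq w z mult_ac)
    then show "cnj (u w) * H2_kernel k (coord_map w) z = u z * cnj (H2_kernel k (coord_map z) w)"
      by (simp only: kernel_symmetric_iff[OF w z])
  qed
qed

end

theorem theorem3p1:
  fixes k :: "'n::{finite,linorder} \<Rightarrow> nat"
    and u :: "(complex, 'n) vec \<Rightarrow> complex"
    and v :: "'n \<Rightarrow> complex \<Rightarrow> complex"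
  assumes "analytic_vec_on u polydisk"
    and "\<exists>z\<in>polydisk. u z \<noteq> 0"
    and "\<And>j. v j holomorphic_on ball 0 1"
    and "\<And>j. v j ` ball 0 1 \<subseteq> ball 0 1"
    and "H2_bounded (wcd_op u (\<lambda>z. \<chi> j. v j (z $ j)) k)"
  shows "H2_hermitian (wcd_op u (\<lambda>z. \<chi> j. v j (z $ j)) k) \<longleftrightarrow>
    (\<exists>(a::real) (d :: 'n \<Rightarrow> real) (c :: 'n \<Rightarrow> complex).
       (\<forall>z\<in>polydisk. u z =
          of_real a * (\<Prod>i\<in>UNIV. (z $ i) ^ k i / (1 - cnj (c i) * z $ i) ^ (k i + 1))) \<and>
       (\<forall>j. \<forall>w\<in>ball 0 1. v j w =
          ((of_real (d j) - of_real ((norm (c j))\<^sup>2)) * w + c j) / (1 - cnj (c j) * w)))"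
proof -
  have V: "(\<chi> j. v j (z $ j)) \<in> polydisk" if "z \<in> polydisk" for z
    using assms(4) that by (auto simp: polydisk_def image_subset_iff)
  show ?thesis
    using hermitian_iff_kernel_symmetric[where V = "\<lambda>z. \<chi> j. v j (z $ j)", OF V assms(5)]
      kernel_symmetric_iff_form[OF analytic_vec_on_imp_continuous_on[OF assms(1)] assms(2-4)]
    by (rule trans)
qed
end
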